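(* Let $\mathbb{F}=\mathbb{R}$ or $\mathbb{F}=\mathbb{C}$, let $m,n$ be positive integers, and let $\underline{d}=(d_1,\ldots,d_m)$ be a list of nonnegative integers with $\max_{1\le i\le m} d_i>0$. Let $\mathrm{TSyl}[\lambda]^{m\times(m+n)}_{\underline{d}}$ be the set of polynomial matrices in $\mathbb{F}[\lambda]^{m\times(m+n)}_{\underline{d}}$ that have full-trimmed-Sylvester-rank. Then the complement of $\mathrm{TSyl}[\lambda]^{m\times(m+n)}_{\underline{d}}$ in $\mathbb{F}[\lambda]^{m\times(m+n)}_{\underline{d}}$ is a proper algebraic set of $\mathbb{F}[\lambda]^{m\times(m+n)}_{\underline{d}}$ and, so, $\mathrm{TSyl}[\lambda]^{m\times(m+n)}_{\underline{d}}$ is a generic set of $\mathbb{F}[\lambda]^{m\times(m+n)}_{\underline{d}}$. Moreover, $\mathrm{TSyl}[\lambda]^{m\times(m+n)}_{\underline{d}}$ is an open and dense subset of $\mathbb{F}[\lambda]^{m\times(m+n)}_{\underline{d}}$ with respect to the Euclidean metric $\rho$.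
   Context: Space: $\mathbb{F}[\lambda]^{m\times(m+n)}_{\underline{d}}$ is the $\mathbb{F}$-linear space of $m\times(m+n)$ polynomial matrices $M(\lambda)$ whose $i$th row has the form $R_i(\lambda)=R_{i,0}+R_{i,1}\lambda+\cdots+R_{i,d_i}\lambda^{d_i}$ with $R_{i,j}\in\mathbb{F}^{1\times(m+n)}$, $i=1,\ldots,m$ (row degrees at most $d_1,\ldots,d_m$). Trimmed Sylvester matrices: put $d=\max_i d_i$ and write $M(\lambda)=M_0+M_1\lambda+\cdots+M_d\lambda^d$. For $k\ge1$, the $k$th Sylvester matrix $S_k(M)\in\mathbb{F}^{(k+d)m\times k(m+n)}$ is the block matrix with $k+d$ block rows (indexed $0,\ldots,k+d-1$) and $k$ block columns (indexed $0,\ldots,k-1$) whose $(p,q)$ block is $M_{p-q}$ if $0\le p-q\le d$ and $0$ otherwise. For each $i$, the submatrix of $S_k(M)$ formed by the $i$th row of each block row has its last $d-d_i$ rows equal to zero. The $k$th trimmed Sylvester matrix $T_k(M)\in\mathbb{F}^{(km+\sum_{i=1}^m d_i)\times k(m+n)}$ is obtained from $S_k(M)$ by deleting, for every $i=1,\ldots,m$, these $d-d_i$ zero rows (i.e. the $i$th row of each of the last $d-d_i$ block rows), keeping the order of the remaining rows. Full-trimmed-Sylvester-rank: $M(\lambda)\in\mathbb{F}[\lambda]^{m\times(m+n)}_{\underline{d}}$ has full-trimmed-Sylvester-rank if $\operatorname{rank} T_k(M)=\min\{km+\sum_{i=1}^m d_i,\;k(m+n)\}$ for all $k=1,2,\ldots$.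 Metric: $\rho(M,\widetilde M)=\sqrt{\sum_{i=1}^m\sum_{j=0}^{d_i}\|R_{i,j}-\widetilde R_{i,j}\|_2^2}$, where $R_{i,j},\widetilde R_{i,j}$ are the row coefficients of $M(\lambda),\widetilde M(\lambda)$. Algebraic and generic sets: an algebraic set in $\mathbb{K}^p$ ($\mathbb{K}=\mathbb{R}$ or $\mathbb{C}$) is the set of common zeros of finitely many polynomials in $p$ variables with coefficients in $\mathbb{K}$; it is proper if it is not all of $\mathbb{K}^p$; a generic set of $\mathbb{K}^p$ is a subset whose complement is contained in a proper algebraic set. Let $V(M)=[R_{1,0}\; R_{1,1}\cdots R_{1,d_1}\;\cdots\; R_{m,0}\cdots R_{m,d_m}]\in\mathbb{F}^{(m+n)\sum_i(d_i+1)}$. When $\mathbb{F}=\mathbb{R}$, algebraic/generic sets of $\mathbb{R}[\lambda]^{m\times(m+n)}_{\underline{d}}$ are defined via the linear bijection $M\mapsto V(M)$ onto $\mathbb{R}^{(m+n)\sum_i(d_i+1)}$. When $\mathbb{F}=\mathbb{C}$, the space is regarded as a real linear space, and algebraic/generic sets of $\mathbb{C}[\lambda]^{m\times(m+n)}_{\underline{d}}$ are defined via the $\mathbb{R}$-linear bijection $M\mapsto W(M)=[\operatorname{Re}V(M)\;\;\operatorname{Im}V(M)]$ onto $\mathbb{R}^{2(m+n)\sum_i(d_i+1)}$ (i.e., real polynomial equations in the real and imaginary parts). *)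

theory Defs
  imports
    "HOL-Analysis.Abstract_Metric_Spaces"
    "HOL-Analysis.L2_Norm"
    "HOL-Library.Poly_Mapping"
    "Jordan_Normal_Form.DL_Rank"
    "Jordan_Normal_Form.DL_Submatrix"
begin

unbundle no vec_syntax
hide_type (open) Finite_Cartesian_Product.vec
hide_const (open) Finite_Cartesian_Product.vec

section \<open>Polynomial matrices with bounded row degrees\<close>

text \<open>Rows, columns and the list \<open>d\<close> of row degree bounds are indexed from 0.\<close>

definition polmat_space :: "nat \<Rightarrow> nat \<Rightarrow> nat list \<Rightarrow> 'a::field poly mat set" where
  "polmat_space m n d =
     {M \<in> carrier_mat m (m + n). \<forall>i<m. \<forall>c<m + n. degree (M $$ (i, c)) \<le> d ! i}"

definition mat_coeff :: "'a::zero poly mat \<Rightarrow> nat \<Rightarrow> 'a mat" where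
  "mat_coeff M k = map_mat (\<lambda>p. poly.coeff p k) M"

text \<open>The coefficient \<open>R\<^sub>i\<^sub>,\<^sub>j\<close> of \<open>\<lambda>\<close> to the power \<open>j\<close> in row \<open>i\<close>.\<close>

definition row_coeff :: "nat \<Rightarrow> nat \<Rightarrow> 'a::zero poly mat \<Rightarrow> nat \<Rightarrow> nat \<Rightarrow> 'a vec" where
  "row_coeff m n M i j = vec (m + n) (\<lambda>c. poly.coeff (M $$ (i, c)) j)"


section \<open>Trimmed Sylvester matrices\<close>

text \<open>Scalar row \<open>r\<close> is row \<open>r mod m\<close> of block row \<open>r div m\<close>, and similarly for
  columns with blocks of width \<open>m + n\<close>.\<close>

definition sylvester :: "nat \<Rightarrow> nat \<Rightarrow> nat list \<Rightarrow> nat \<Rightarrow> 'a::zero poly mat \<Rightarrow> 'a mat" where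
  "sylvester m n d k M = mat ((k + Max (set d)) * m) (k * (m + n)) (\<lambda>(r, c).
     let p = r div m; q = c div (m + n) in
     if q \<le> p \<and> p - q \<le> Max (set d)
     then mat_coeff M (p - q) $$ (r mod m, c mod (m + n)) else 0)"

text \<open>Row \<open>i\<close> survives exactly in the block rows with index below \<open>k + d\<^sub>i\<close>, that is, it is
  deleted from the last \<open>Max d - d\<^sub>i\<close> of the \<open>k + Max d\<close> block rows.\<close>

definition trimmed_sylvester ::
    "nat \<Rightarrow> nat \<Rightarrow> nat list \<Rightarrow> nat \<Rightarrow> 'a::zero poly mat \<Rightarrow> 'a mat" where
  "trimmed_sylvester m n d k M =
     submatrix (sylvester m n d k M) {r. r div m < k + d ! (r mod m)} UNIV"

lemma trimmed_sylvester_carrier: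
  assumes "m > 0" "length d = m"
  shows "trimmed_sylvester m n d k M \<in> carrier_mat (k * m + sum_list d) (k * (m + n))"
proof -
  let ?D = "Max (set d)"
  let ?S = "{r. r < (k + ?D) * m \<and> r div m < k + d ! (r mod m)}"
  have le: "d ! i \<le> ?D" if "i < m" for i
    using that assms by (simp add: nth_mem)
  have "bij_betw (\<lambda>r. (r mod m, r div m)) ?S (SIGMA i:{..<m}. {..<k + d ! i})"
  proof (rule bij_betw_byWitness[where f' = "\<lambda>(i, p). p * m + i"])
    show "(\<lambda>(i, p). p * m + i) ` (SIGMA i:{..<m}. {..<k + d ! i}) \<subseteq> ?S"
    proof clarsimp
      fix i p assume ip: "i < m" "p < k + d ! i"
      then have "Suc p \<le> k + ?D" using le[of i] by linarith
      then have "Suc p * m \<le> (k + ?D) * m" by (rule mult_le_mono1)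
      then show "p * m + i < (k + ?D) * m" using ip by simp
    qed
  qed (use assms in auto)
  then have "card ?S = (\<Sum>i<m. k + d ! i)"
    by (simp add: bij_betw_same_card)
  also have "\<dots> = k * m + sum_list d"
    using assms by (simp add: sum.distrib sum_list_sum_nth atLeast0LessThan)
  finally have "card ?S = k * m + sum_list d" .
  then show ?thesis
    unfolding trimmed_sylvester_def carrier_mat_def
    by (simp add: dim_submatrix sylvester_def)
qed

definition full_trimmed_sylvester_rank ::
    "nat \<Rightarrow> nat \<Rightarrow> nat list \<Rightarrow> 'a::field poly mat \<Rightarrow> bool" where
  "full_trimmed_sylvester_rank m n d M \<longleftrightarrow>
     (\<forall>k\<ge>1. vec_space.rank (k * m + sum_list d) (trimmed_sylvester m n d k M)
            = min (k * m + sum_list d) (k * (m + n)))"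

definition TSyl :: "nat \<Rightarrow> nat \<Rightarrow> nat list \<Rightarrow> 'a::field poly mat set" where
  "TSyl m n d = {M \<in> polmat_space m n d. full_trimmed_sylvester_rank m n d M}"


section \<open>The Euclidean metric\<close>

definition polmat_dist ::
    "nat \<Rightarrow> nat \<Rightarrow> nat list \<Rightarrow> 'a::real_normed_field poly mat \<Rightarrow> 'a poly mat \<Rightarrow> real" where
  "polmat_dist m n d M M' =
     sqrt (\<Sum>i<m. \<Sum>j\<le>d ! i. \<Sum>c<m + n.
       (norm ((row_coeff m n M i j - row_coeff m n M' i j) $ c))\<^sup>2)"

abbreviation polmat_topology ::
    "nat \<Rightarrow> nat \<Rightarrow> nat list \<Rightarrow> 'a::real_normed_field poly mat topology" where
  "polmat_topology m n d \<equiv> Metric_space.mtopology (polmat_space m n d) (polmat_dist m n d)"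

lemma Metric_space_polmat:
  "Metric_space (polmat_space m n d :: 'a::real_normed_field poly mat set) (polmat_dist m n d)"
proof -
  define I where "I = (SIGMA i:{..<m}. {..d ! i} \<times> {..<m + n})"
  define f where "f = (\<lambda>(M :: 'a poly mat) (i, j, c). poly.coeff (M $$ (i, c)) j)"
  have fin: "finite I" by (simp add: I_def)
  have dist: "polmat_dist m n d M M' = L2_set (\<lambda>x. norm (f M x - f M' x)) I"
    for M M' :: "'a poly mat"
    by (simp add: polmat_dist_def L2_set_def I_def f_def row_coeff_def
          sum.Sigma sum.cartesian_product split_def)
  show ?thesis
  proof
    fix M M' :: "'a poly mat"
    show "0 \<le> polmat_dist m n d M M'" by (simp add: dist)
    show "polmat_dist m n d M M' = polmat_dist m n d M' M"
      by (simp add: dist norm_minus_commute)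
  next
    fix M M' :: "'a poly mat"
    assume M: "M \<in> polmat_space m n d" and M': "M' \<in> polmat_space m n d"
    have "M = M'" if eq: "\<forall>x\<in>I. f M x = f M' x"
    proof (rule eq_matI)
      fix i c assume "i < dim_row M'" "c < dim_col M'"
      then have ic: "i < m" "c < m + n" using M' by (auto simp: polmat_space_def)
      have "poly.coeff (M $$ (i, c)) j = poly.coeff (M' $$ (i, c)) j" for j
      proof (cases "j \<le> d ! i")
        case True
        then have "(i, j, c) \<in> I" using ic by (simp add: I_def)
        then show ?thesis using eq by (force simp: f_def)
      next
        case False
        then have "degree (M $$ (i, c)) < j" "degree (M' $$ (i, c)) < j"
          using M M' ic by (force simp: polmat_space_def)+
        then show ?thesis by (simp add: coeff_eq_0)
      qed
      then show "M $$ (i, c) = M' $$ (i, c)" by (simp add: poly_eq_iff)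
    qed (use M M' in \<open>auto simp: polmat_space_def\<close>)
    then show "polmat_dist m n d M M' = 0 \<longleftrightarrow> M = M'"
      by (auto simp: dist L2_set_eq_0_iff fin)
  next
    fix M1 M2 M3 :: "'a poly mat"
    have "L2_set (\<lambda>x. norm (f M1 x - f M3 x)) I
        \<le> L2_set (\<lambda>x. norm (f M1 x - f M2 x) + norm (f M2 x - f M3 x)) I"
      by (rule L2_set_mono) (auto intro: norm_diff_triangle_le)
    also have "\<dots> \<le> L2_set (\<lambda>x. norm (f M1 x - f M2 x)) I
        + L2_set (\<lambda>x. norm (f M2 x - f M3 x)) I"
      by (rule L2_set_triangle_ineq)
    finally show "polmat_dist m n d M1 M3 \<le> polmat_dist m n d M1 M2 + polmat_dist m n d M2 M3"
      by (simp add: dist)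
  qed
qed


section \<open>Algebraic and generic sets\<close>

text \<open>A polynomial with coefficients in \<open>'a\<close> is a finitely supported map from monomials to
  coefficients, a monomial being a finitely supported map from variables to exponents.\<close>

definition mpoly_eval :: "((nat \<Rightarrow>\<^sub>0 nat) \<Rightarrow>\<^sub>0 'a::comm_ring_1) \<Rightarrow> 'a vec \<Rightarrow> 'a" where
  "mpoly_eval f x = (\<Sum>u\<in>Poly_Mapping.keys f. Poly_Mapping.lookup f u *
     (\<Prod>i\<in>Poly_Mapping.keys u. (x $ i) ^ Poly_Mapping.lookup u i))"

definition mpolys_in :: "nat \<Rightarrow> ((nat \<Rightarrow>\<^sub>0 nat) \<Rightarrow>\<^sub>0 'a::comm_ring_1) set" where
  "mpolys_in N = {f. \<forall>u\<in>Poly_Mapping.keys f. Poly_Mapping.keys u \<subseteq> {..<N}}"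

definition algebraic_set :: "nat \<Rightarrow> 'a::comm_ring_1 vec set \<Rightarrow> bool" where
  "algebraic_set N A \<longleftrightarrow>
     (\<exists>F\<subseteq>mpolys_in N. finite F \<and> A = {x \<in> carrier_vec N. \<forall>f\<in>F. mpoly_eval f x = 0})"

definition proper_algebraic_set :: "nat \<Rightarrow> 'a::comm_ring_1 vec set \<Rightarrow> bool" where
  "proper_algebraic_set N A \<longleftrightarrow> algebraic_set N A \<and> A \<noteq> carrier_vec N"

definition generic_set :: "nat \<Rightarrow> 'a::comm_ring_1 vec set \<Rightarrow> bool" where
  "generic_set N G \<longleftrightarrow> G \<subseteq> carrier_vec N \<and>
     (\<exists>A. proper_algebraic_set N A \<and> carrier_vec N - G \<subseteq> A)"

text \<open>The coordinate vector \<open>V(M)\<close>, and its real version \<open>W(M)\<close> for complex matrices.\<close>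

definition coord_vec :: "nat \<Rightarrow> nat \<Rightarrow> nat list \<Rightarrow> 'a::zero poly mat \<Rightarrow> 'a vec" where
  "coord_vec m n d M = vec_of_list (concat (map (\<lambda>i.
     concat (map (\<lambda>j. list_of_vec (row_coeff m n M i j)) [0..<d ! i + 1])) [0..<m]))"

definition coord_vec_reim :: "nat \<Rightarrow> nat \<Rightarrow> nat list \<Rightarrow> complex poly mat \<Rightarrow> real vec" where
  "coord_vec_reim m n d M =
     map_vec Re (coord_vec m n d M) @\<^sub>v map_vec Im (coord_vec m n d M)"

definition coord_dim :: "nat \<Rightarrow> nat \<Rightarrow> nat list \<Rightarrow> nat" where
  "coord_dim m n d = (m + n) * (\<Sum>i<m. d ! i + 1)"

definition proper_algebraic_real :: "nat \<Rightarrow> nat \<Rightarrow> nat list \<Rightarrow> real poly mat set \<Rightarrow> bool" where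
  "proper_algebraic_real m n d A \<longleftrightarrow> A \<subseteq> polmat_space m n d \<and>
     proper_algebraic_set (coord_dim m n d) (coord_vec m n d ` A)"

definition generic_real :: "nat \<Rightarrow> nat \<Rightarrow> nat list \<Rightarrow> real poly mat set \<Rightarrow> bool" where
  "generic_real m n d G \<longleftrightarrow> G \<subseteq> polmat_space m n d \<and>
     generic_set (coord_dim m n d) (coord_vec m n d ` G)"

definition proper_algebraic_complex ::
    "nat \<Rightarrow> nat \<Rightarrow> nat list \<Rightarrow> complex poly mat set \<Rightarrow> bool" where
  "proper_algebraic_complex m n d A \<longleftrightarrow> A \<subseteq> polmat_space m n d \<and>
     proper_algebraic_set (2 * coord_dim m n d) (coord_vec_reim m n d ` A)"

definition generic_complex :: "nat \<Rightarrow> nat \<Rightarrow> nat list \<Rightarrow> complex poly mat set \<Rightarrow> bool" where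
  "generic_complex m n d G \<longleftrightarrow> G \<subseteq> polmat_space m n d \<and>
     generic_set (2 * coord_dim m n d) (coord_vec_reim m n d ` G)"

end

theory Submission
  imports Defs
begin

text \<open>Write \<open>a\<close> for the sum of the row degrees. The matrix \<open>T\<^sub>k\<close> represents \<open>v \<mapsto> M v\<close> on polynomial vectors
  of degree below \<open>k\<close>, so full rank means injectivity when \<open>k n \<le> a\<close> and surjectivity otherwise.
  Injectivity is inherited by smaller \<open>k\<close> and surjectivity by larger \<open>k\<close>; hence only
  \<open>k = a div n\<close> and \<open>k = a div n + 1\<close> matter. Each of these two conditions is the nonvanishing
  of a Gram determinant, and so \<open>TSyl\<close> is the nonvanishing set of a single real polynomial in the
  (real and imaginary parts of the) coefficients. That polynomial is not identically zero, as an
  explicit zigzag matrix of monomials shows, and a nonzero polynomial restricted to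
  a line through a point where it does not vanish has only finitely many zeros, which gives density.\<close>

section \<open>Rank and trivial kernels\<close>

text \<open>Full rank for all \<open>k\<close> is a priori an infinite intersection of nonvanishing
  conditions, which need be neither open nor the complement of an algebraic set; monotonicity in
  \<open>k\<close> makes it finite. Surjectivity passes from \<open>k\<close> to
  \<open>k + 1\<close> because, for \<open>k \<ge> 1\<close>, vectors with row bounds
  \<open>k + 1 + d ! i\<close> are spanned by those with bounds \<open>k + d ! i\<close> and their
  multiples by \<lambda>. A Gram determinant replaces the family of maximal minors of a nonsquare
  matrix; over the complex numbers it needs conjugation, which is polynomial only in real and
  imaginary parts. The kernel positions of the explicit matrix are the floors of
  \<open>j * a / n\<close>: their gaps are at least every integer \<open>k \<le> a / n\<close> and
  at most every integer \<open>k \<ge> a / n\<close>, so one matrix meets both conditions.\<close>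

definition trivial_kernel :: "'x set \<Rightarrow> 'y set \<Rightarrow> ('x \<Rightarrow> 'y \<Rightarrow> 'a::field) \<Rightarrow> bool" where
  "trivial_kernel I J B \<longleftrightarrow>
     (\<forall>v. (\<forall>x\<in>I. (\<Sum>y\<in>J. B x y * v y) = 0) \<longrightarrow> (\<forall>y\<in>J. v y = 0))"

lemma trivial_kernelD:
  assumes "trivial_kernel I J B" "\<And>x. x \<in> I \<Longrightarrow> (\<Sum>y\<in>J. B x y * v y) = 0" "y \<in> J"
  shows "v y = 0"
  using assms unfolding trivial_kernel_def by blast

text \<open>By maximality, adjoining a further column to \<open>S\<close> creates a dependence, so
  \<open>S\<close> spans all columns. Orthogonality to every column can then be tested on
  \<open>S\<close> alone.\<close>

lemma (in vec_space) rank_eq_card_indpt_cols: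
  assumes "A \<in> carrier_mat n nc"
  obtains S where "S \<subseteq> set (cols A)" "lin_indpt S" "rank A = card S" "set (cols A) \<subseteq> span S"
proof -
  have car: "set (cols A) \<subseteq> carrier_vec n" using assms cols_dim by blast
  obtain S where S: "maximal S (\<lambda>T. T \<subseteq> set (cols A) \<and> lin_indpt T)"
    using maximal_exists[of "(\<lambda>T. T \<subseteq> set (cols A) \<and> lin_indpt T)" "card (set (cols A))" "{}"]
    by (meson List.finite_set card_mono empty_iff empty_subsetI finite_lin_indpt2 rev_finite_subset)
  then have sub: "S \<subseteq> set (cols A)" and li: "lin_indpt S" by (auto simp: maximal_def)
  have "c \<in> span S" if c: "c \<in> set (cols A)" for c
  proof (cases "c \<in> S")
    case True
    then show ?thesis using in_own_span sub car by (metis subset_iff subset_trans)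
  next
    case False
    then have "lin_dep (insert c S)" using S c unfolding maximal_def by blast
    then show ?thesis using lin_dep_iff_in_span[of S c] sub car li c False by auto
  qed
  then show ?thesis using that[OF sub li rank_card_indpt[OF assms S]] by blast
qed

lemma (in vec_space) scalar_prod_span_zero:
  assumes "S \<subseteq> carrier_vec n" "z \<in> carrier_vec n" "\<And>s. s \<in> S \<Longrightarrow> scalar_prod z s = 0" "w \<in> span S"
  shows "scalar_prod z w = 0"
proof -
  obtain a F where F: "finite F" "F \<subseteq> S" and w: "w = lincomb a F"
    using assms(4) by (auto simp: span_def)
  have Fc: "F \<subseteq> carrier_vec n" using F assms(1) by auto
  have "scalar_prod z w = (\<Sum>i<n. z $ i * (\<Sum>x\<in>F. a x * x $ i))"
    using lincomb_dim[OF F(1) Fc] by (simp add: w scalar_prod_def lincomb_index[OF _ Fc] atLeast0LessThan)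
  also have "\<dots> = (\<Sum>x\<in>F. a x * (\<Sum>i<n. z $ i * x $ i))"
    by (simp add: sum_distrib_left mult_ac) (rule sum.swap)
  also have "\<dots> = (\<Sum>x\<in>F. a x * scalar_prod z x)"
    using Fc by (intro sum.cong) (auto simp: scalar_prod_def atLeast0LessThan dest!: subsetD)
  also have "\<dots> = 0" using F assms(3) by (intro sum.neutral) auto
  finally show ?thesis .
qed

text \<open>Independence is a property of the set of columns, which forgets repetitions, so each
  direction first has to show that the columns are distinct.\<close>

lemma rank_eq_ncols_iff:
  fixes A :: "'a::field mat"
  assumes A: "A \<in> carrier_mat nr nc"
  shows "vec_space.rank nr A = nc \<longleftrightarrow> (\<forall>v\<in>carrier_vec nc. A *\<^sub>v v = 0\<^sub>v nr \<longrightarrow> v = 0\<^sub>v nc)"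
proof -
  interpret vec_space "TYPE('a)" nr .
  show ?thesis
  proof
    assume r: "rank A = nc"
    obtain S where S: "S \<subseteq> set (cols A)" "rank A = card S" using rank_eq_card_indpt_cols[OF A] by metis
    have "nc \<le> card (set (cols A))" using S r by (metis List.finite_set card_mono)
    then have d: "distinct (cols A)" using A by (metis card_distinct card_length carrier_matD(2) cols_length le_antisym)
    then have "lin_indpt (set (cols A))" using full_rank_lin_indpt[OF A r] by simp
    then show "\<forall>v\<in>carrier_vec nc. A *\<^sub>v v = 0\<^sub>v nr \<longrightarrow> v = 0\<^sub>v nc"
      using lin_depI[OF A] d by blast
  next
    assume inj: "\<forall>v\<in>carrier_vec nc. A *\<^sub>v v = 0\<^sub>v nr \<longrightarrow> v = 0\<^sub>v nc"
    have d: "distinct (cols A)"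
    proof (rule ccontr)
      assume "\<not> distinct (cols A)"
      then obtain i j where ij: "i < nc" "j < nc" "i \<noteq> j" "col A i = col A j"
        using A by (auto simp: distinct_conv_nth)
      let ?v = "unit_vec nc i - unit_vec nc j :: 'a vec"
      have col: "A *\<^sub>v unit_vec nc l = col A l" if "l < nc" for l
        using A that by (intro eq_vecI) auto
      have "A *\<^sub>v ?v = col A i - col A j"
        using A ij by (simp add: mult_minus_distrib_mat_vec[OF A] col)
      then have "A *\<^sub>v ?v = 0\<^sub>v nr" using A ij by auto
      then have "?v = 0\<^sub>v nc" using inj by simp
      then have "?v $ i = (0::'a)" using ij by simp
      then show False using ij by simp
    qed
    have "lin_indpt (set (cols A))" using lin_depE[OF A _ d] inj by metis
    then show "rank A = nc" by (rule lin_indpt_full_rank[OF A d])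
  qed
qed

text \<open>A vector killed by the transpose is orthogonal to all columns, equivalently to a maximal
  independent set \<open>S\<close> of them. A square matrix with the same orthogonality condition
  reduces the claim to determinants.\<close>

lemma rank_eq_nrows_iff:
  fixes A :: "'a::field mat"
  assumes A: "A \<in> carrier_mat nr nc"
  shows "vec_space.rank nr A = nr \<longleftrightarrow>
    (\<forall>z\<in>carrier_vec nr. transpose_mat A *\<^sub>v z = 0\<^sub>v nc \<longrightarrow> z = 0\<^sub>v nr)"
proof -
  interpret vec_space "TYPE('a)" nr .
  obtain S where S: "S \<subseteq> set (cols A)" "lin_indpt S" "rank A = card S" "set (cols A) \<subseteq> span S"
    using rank_eq_card_indpt_cols[OF A] by metis
  have car: "S \<subseteq> carrier_vec nr" using S A cols_dim by blast
  have fin: "finite S" using S finite_subset by blast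
  obtain xs where xs: "set xs = S" "distinct xs" using finite_distinct_list[OF fin] by auto
  have len: "length xs = rank A" using S xs distinct_card by metis
  have le: "rank A \<le> nr" using li_le_dim(2)[OF fin_dim _ S(2)] car S(3) dim_is_n by auto
  have iff: "transpose_mat A *\<^sub>v z = 0\<^sub>v nc \<longleftrightarrow> (\<forall>s\<in>S. scalar_prod z s = 0)" if z: "z \<in> carrier_vec nr" for z
  proof -
    have "transpose_mat A *\<^sub>v z = 0\<^sub>v nc \<longleftrightarrow> (\<forall>j<nc. scalar_prod z (col A j) = 0)"
    proof -
      have "(transpose_mat A *\<^sub>v z) $ j = scalar_prod z (col A j)" if "j < nc" for j
        using A z that by (simp add: comm_scalar_prod[of _ nr])
      then show ?thesis using A by (auto simp: vec_eq_iff)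
    qed
    also have "\<dots> \<longleftrightarrow> (\<forall>s\<in>set (cols A). scalar_prod z s = 0)"
      using A by (auto simp: cols_def)
    also have "\<dots> \<longleftrightarrow> (\<forall>s\<in>S. scalar_prod z s = 0)"
      using S scalar_prod_span_zero[OF car z] by blast
    finally show ?thesis .
  qed
  \<comment> \<open>Padding a maximal independent set of columns with zero columns gives a square matrix.\<close>
  define B where "B = mat_of_cols nr (xs @ replicate (nr - length xs) (0\<^sub>v nr))"
  have B: "B \<in> carrier_mat nr nr" using len le by (auto simp: B_def)
  have colsB: "cols B = xs @ replicate (nr - length xs) (0\<^sub>v nr)"
    unfolding B_def using car xs by (intro cols_mat_of_cols) (auto simp: set_replicate_conv_if)
  have "transpose_mat B *\<^sub>v z = 0\<^sub>v nr \<longleftrightarrow> (\<forall>s\<in>S. scalar_prod z s = 0)" if z: "z \<in> carrier_vec nr" for z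
  proof -
    have "transpose_mat B *\<^sub>v z = 0\<^sub>v nr \<longleftrightarrow> (\<forall>j<nr. scalar_prod z (col B j) = 0)"
    proof -
      have "(transpose_mat B *\<^sub>v z) $ j = scalar_prod z (col B j)" if "j < nr" for j
        using B z that by (simp add: comm_scalar_prod[of _ nr])
      then show ?thesis using B by (auto simp: vec_eq_iff)
    qed
    also have "\<dots> \<longleftrightarrow> (\<forall>s\<in>set (cols B). scalar_prod z s = 0)"
      using B by (auto simp: cols_def)
    also have "\<dots> \<longleftrightarrow> (\<forall>s\<in>S. scalar_prod z s = 0)"
      using z by (auto simp: colsB xs set_replicate_conv_if)
    finally show ?thesis .
  qed
  then have "(\<forall>z\<in>carrier_vec nr. transpose_mat A *\<^sub>v z = 0\<^sub>v nc \<longrightarrow> z = 0\<^sub>v nr) \<longleftrightarrow> det B \<noteq> 0"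
    using iff det_0_iff_vec_prod_zero_field[of "transpose_mat B" nr] B det_transpose[OF B] by auto
  also have "\<dots> \<longleftrightarrow> rank A = nr"
  proof
    assume "det B \<noteq> 0"
    then have "rank B = nr" using det_rank_iff[OF B] by simp
    obtain T where T: "T \<subseteq> set (cols B)" "lin_indpt T" "rank B = card T"
      using rank_eq_card_indpt_cols[OF B] by metis
    \<comment> \<open>An independent set cannot contain a zero column used as padding, so
      \<open>T\<close> already lies in \<open>S\<close>.\<close>
    have "0\<^sub>v nr \<notin> T" using T vs_zero_lin_dep[of T] B cols_dim[of B] by force
    then have "T \<subseteq> S" using T(1) by (auto simp: colsB xs set_replicate_conv_if split: if_splits)
    then show "rank A = nr" using T S fin le \<open>rank B = nr\<close> by (metis card_mono le_antisym)
  next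
    assume r: "rank A = nr"
    then have "cols B = xs" using len by (simp add: colsB)
    then have "rank B = nr" using lin_indpt_full_rank[OF B] xs S by simp
    then show "det B \<noteq> 0" using det_rank_iff[OF B] by simp
  qed
  finally show ?thesis by simp
qed

text \<open>Numbering does not affect a kernel: \<open>f\<close> and \<open>g\<close> merely rename
  rows and columns. From here on, the row order left by trimming can be ignored.\<close>

lemma trivial_kernel_mat:
  fixes A :: "'a::field mat"
  assumes A: "A \<in> carrier_mat nr nc"
    and f: "bij_betw f {..<nr} I" and g: "bij_betw g {..<nc} J"
    and AB: "\<And>r s. r < nr \<Longrightarrow> s < nc \<Longrightarrow> A $$ (r, s) = B (f r) (g s)"
  shows "(\<forall>v\<in>carrier_vec nc. A *\<^sub>v v = 0\<^sub>v nr \<longrightarrow> v = 0\<^sub>v nc) \<longleftrightarrow> trivial_kernel I J B"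
proof -
  have mult: "(A *\<^sub>v v) $ r = (\<Sum>y\<in>J. B (f r) y * w y)"
    if "r < nr" "v \<in> carrier_vec nc" "\<And>s. s < nc \<Longrightarrow> v $ s = w (g s)" for v w r
  proof -
    have "(A *\<^sub>v v) $ r = (\<Sum>s<nc. B (f r) (g s) * w (g s))"
      using A that by (auto simp: scalar_prod_def AB atLeast0LessThan)
    then show ?thesis using sum.reindex_bij_betw[OF g, of "\<lambda>y. B (f r) y * w y"] by simp
  qed
  have I: "(\<forall>x\<in>I. P x) \<longleftrightarrow> (\<forall>r<nr. P (f r))" for P
    using f by (metis bij_betwE bij_betw_imp_surj_on imageE lessThan_iff)
  have J: "(\<forall>y\<in>J. P y) \<longleftrightarrow> (\<forall>s<nc. P (g s))" for P
    using g by (metis bij_betwE bij_betw_imp_surj_on imageE lessThan_iff)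
  show ?thesis
  proof
    assume L: "\<forall>v\<in>carrier_vec nc. A *\<^sub>v v = 0\<^sub>v nr \<longrightarrow> v = 0\<^sub>v nc"
    show "trivial_kernel I J B"
      unfolding trivial_kernel_def
    proof (intro allI impI)
      fix w assume w: "\<forall>x\<in>I. (\<Sum>y\<in>J. B x y * w y) = 0"
      let ?v = "vec nc (\<lambda>s. w (g s))"
      have "A *\<^sub>v ?v = 0\<^sub>v nr"
        using A w by (intro eq_vecI) (auto simp del: index_mult_mat_vec simp: mult[of _ ?v w] I)
      then have "?v = 0\<^sub>v nc" using L by auto
      then show "\<forall>y\<in>J. w y = 0" by (auto simp: J vec_eq_iff)
    qed
  next
    assume R: "trivial_kernel I J B"
    show "\<forall>v\<in>carrier_vec nc. A *\<^sub>v v = 0\<^sub>v nr \<longrightarrow> v = 0\<^sub>v nc"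
    proof (intro ballI impI)
      fix v assume v: "v \<in> carrier_vec nc" "A *\<^sub>v v = 0\<^sub>v nr"
      define w where "w = (\<lambda>y. v $ (the_inv_into {..<nc} g y))"
      have w: "v $ s = w (g s)" if "s < nc" for s
        using that g by (simp add: w_def the_inv_into_f_f bij_betw_def)
      have "\<forall>x\<in>I. (\<Sum>y\<in>J. B x y * w y) = 0"
        using mult[OF _ v(1) w] v(2) by (auto simp: I)
      then have "\<forall>y\<in>J. w y = 0" using R by (simp add: trivial_kernel_def)
      then show "v = 0\<^sub>v nc" using v(1) w by (auto simp: J vec_eq_iff)
    qed
  qed
qed

text \<open>The conjugate transpose of \<open>B\<close> times \<open>B\<close>; the enumeration
  \<open>g\<close> fixes an order of the columns so that a determinant can be taken.\<close>

definition gram_mat :: "'x set \<Rightarrow> (nat \<Rightarrow> 'y) \<Rightarrow> nat \<Rightarrow> ('x \<Rightarrow> 'y \<Rightarrow> 'a::conjugatable_ordered_field) \<Rightarrow> 'a mat" where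
  "gram_mat I g N B = mat N N (\<lambda>(r, s). \<Sum>x\<in>I. conjugate (B x (g r)) * B x (g s))"

lemma det_gram_mat_iff:
  assumes I: "finite I" and g: "bij_betw g {..<N} J"
  shows "det (gram_mat I g N B) \<noteq> 0 \<longleftrightarrow> trivial_kernel I J B"
proof -
  have fJ: "finite J" using g bij_betw_finite by blast
  have H: "gram_mat I g N B \<in> carrier_mat N N" by (simp add: gram_mat_def)
  define G where "G = (\<lambda>y y'. \<Sum>x\<in>I. conjugate (B x y) * B x y')"
  have G: "(\<Sum>y'\<in>J. G y y' * v y') = (\<Sum>x\<in>I. conjugate (B x y) * (\<Sum>y'\<in>J. B x y' * v y'))" for v y
    unfolding G_def by (simp add: sum_distrib_right sum_distrib_left mult.assoc) (rule sum.swap)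
  have "trivial_kernel J J G \<longleftrightarrow> trivial_kernel I J B"
  proof -
    have "(\<forall>y\<in>J. (\<Sum>y'\<in>J. G y y' * v y') = 0) \<longleftrightarrow> (\<forall>x\<in>I. (\<Sum>y\<in>J. B x y * v y) = 0)" for v
    proof
      assume 0: "\<forall>y\<in>J. (\<Sum>y'\<in>J. G y y' * v y') = 0"
      define b where "b = (\<lambda>x. \<Sum>y\<in>J. B x y * v y)"
      \<comment> \<open>The Hermitian form of \<open>G\<close> at \<open>v\<close> in two ways: as
        the squared norm of \<open>B v\<close>, and as \<open>v\<close> paired with
        \<open>G v\<close>, which is zero.\<close>
      have "(\<Sum>x\<in>I. b x * conjugate (b x)) = (\<Sum>x\<in>I. \<Sum>y\<in>J. conjugate (v y) * (conjugate (B x y) * b x))"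
        by (subst (2) b_def) (simp add: sum_conjugate[OF fJ] conjugate_dist_mul sum_distrib_left mult_ac)
      also have "\<dots> = (\<Sum>y\<in>J. conjugate (v y) * (\<Sum>x\<in>I. conjugate (B x y) * b x))"
        unfolding sum_distrib_left by (rule sum.swap)
      also have "\<dots> = 0" using 0 by (intro sum.neutral) (simp add: G b_def)
      finally have "\<forall>x\<in>I. b x * conjugate (b x) = 0"
        using sum_nonneg_eq_0_iff[OF I, of "\<lambda>x. b x * conjugate (b x)"] conjugate_square_positive by blast
      then show "\<forall>x\<in>I. (\<Sum>y\<in>J. B x y * v y) = 0" by (simp add: b_def)
    qed (simp add: G)
    then show ?thesis by (simp add: trivial_kernel_def)
  qed
  moreover have "det (gram_mat I g N B) \<noteq> 0 \<longleftrightarrow> trivial_kernel J J G"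
    using trivial_kernel_mat[OF H g g, of G] det_0_iff_vec_prod_zero_field[OF H]
    by (auto simp: gram_mat_def G_def)
  ultimately show ?thesis by simp
qed

lemma polmat_coeff_eq_0:
  assumes "M \<in> polmat_space m n d" "i < m" "c < m + n" "d ! i < j"
  shows "poly.coeff (M $$ (i, c)) j = 0"
proof (rule coeff_eq_0)
  have "degree (M $$ (i, c)) \<le> d ! i" using assms by (simp add: polmat_space_def)
  then show "degree (M $$ (i, c)) < j" using assms(4) by linarith
qed

section \<open>Trimmed Sylvester matrices as bilinear index families\<close>

text \<open>Scalar rows are indexed by \<open>(i, p)\<close> (row of \<open>M\<close>, power of \<open>\<lambda>\<close>), scalar columns by \<open>(c, q)\<close>.\<close>

definition syl_rows :: "nat \<Rightarrow> nat list \<Rightarrow> nat \<Rightarrow> (nat \<times> nat) set" where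
  "syl_rows m d k = (SIGMA i:{..<m}. {..<k + d ! i})"

definition syl_cols :: "nat \<Rightarrow> nat \<Rightarrow> nat \<Rightarrow> (nat \<times> nat) set" where
  "syl_cols m n k = {..<m + n} \<times> {..<k}"

text \<open>The guard compensates for truncated subtraction. The cutoff at
  \<open>Max (set d)\<close> in \<open>sylvester\<close> is implicit here, since coefficients beyond
  the row degrees vanish.\<close>

definition syl_entry :: "'a::field poly mat \<Rightarrow> nat \<times> nat \<Rightarrow> nat \<times> nat \<Rightarrow> 'a" where
  "syl_entry M = (\<lambda>(i, p) (c, q). if q \<le> p then poly.coeff (M $$ (i, c)) (p - q) else 0)"

lemma bij_betw_pick:
  assumes "finite R"
  shows "bij_betw (pick R) {..<card R} R"
proof -
  have inj: "inj_on (pick R) {..<card R}"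
    by (rule inj_onI) (metis card_pick lessThan_iff)
  have "pick R ` {..<card R} \<subseteq> R" by (auto intro: pick_in_set_le)
  then have "pick R ` {..<card R} = R"
    using assms card_image[OF inj] by (intro card_subset_eq) auto
  with inj show ?thesis by (simp add: bij_betw_def)
qed

lemma bij_betw_syl_rows:
  assumes "m > 0" "length d = m"
  shows "bij_betw (\<lambda>r. (r mod m, r div m))
    {r. r < (k + Max (set d)) * m \<and> r div m < k + d ! (r mod m)} (syl_rows m d k)"
  unfolding syl_rows_def
proof (rule bij_betw_byWitness[where f' = "\<lambda>(i, p). p * m + i"])
  have le: "d ! i \<le> Max (set d)" if "i < m" for i
    using that assms by (simp add: nth_mem)
  show "(\<lambda>(i, p). p * m + i) ` (SIGMA i:{..<m}. {..<k + d ! i})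
      \<subseteq> {r. r < (k + Max (set d)) * m \<and> r div m < k + d ! (r mod m)}"
  proof clarsimp
    fix i p assume ip: "i < m" "p < k + d ! i"
    then have "Suc p \<le> k + Max (set d)" using le[of i] by linarith
    then have "Suc p * m \<le> (k + Max (set d)) * m" by (rule mult_le_mono1)
    then show "p * m + i < (k + Max (set d)) * m" using ip by simp
  qed
qed (use assms in auto)

lemma bij_betw_syl_cols:
  assumes "m > 0"
  shows "bij_betw (\<lambda>s. (s mod (m + n), s div (m + n))) {..<k * (m + n)} (syl_cols m n k)"
  unfolding syl_cols_def
proof (rule bij_betw_byWitness[where f' = "\<lambda>(c, q). q * (m + n) + c"])
  show "(\<lambda>(c, q). q * (m + n) + c) ` ({..<m + n} \<times> {..<k}) \<subseteq> {..<k * (m + n)}"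
  proof clarsimp
    fix c q assume cq: "c < m + n" "q < k"
    then have "Suc q * (m + n) \<le> k * (m + n)" by (intro mult_le_mono1) simp
    then show "q * (m + n) + c < k * (m + n)" using cq by simp
  qed
qed (use assms in \<open>auto simp: less_mult_imp_div_less div_mult_mod_eq\<close>)

text \<open>\<open>submatrix\<close> numbers the surviving rows by \<open>pick\<close>; division
  with remainder by \<open>m\<close> turns each original row number into a pair of row and
  power.\<close>

lemma trimmed_sylvester_entry:
  assumes md: "m > 0" "length d = m" and M: "M \<in> polmat_space m n d"
  obtains f where "bij_betw f {..<k * m + sum_list d} (syl_rows m d k)"
    and "\<And>r s. r < k * m + sum_list d \<Longrightarrow> s < k * (m + n) \<Longrightarrow>
      trimmed_sylvester m n d k M $$ (r, s) = syl_entry M (f r) (s mod (m + n), s div (m + n))"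
proof -
  let ?D = "Max (set d)" and ?N = "(k + Max (set d)) * m"
  define R where "R = {r. r div m < k + d ! (r mod m)}"
  have le: "d ! i \<le> ?D" if "i < m" for i
    using that md by (simp add: nth_mem)
  have RN: "r < ?N" if "r \<in> R" for r
  proof -
    have "d ! (r mod m) \<le> ?D" using md by (intro le) simp
    then have "r div m < k + ?D" using that unfolding R_def by simp
    then show ?thesis using md by (simp add: div_less_iff_less_mult)
  qed
  then have fin: "finite R" by (meson finite_nat_set_iff_bounded)
  have R: "{r. r < ?N \<and> r \<in> R} = R" using RN by auto
  have card: "card R = k * m + sum_list d"
    using trimmed_sylvester_carrier[OF md, of n k M] unfolding carrier_mat_def
    by (simp add: trimmed_sylvester_def dim_submatrix sylvester_def R flip: R_def)
  show ?thesis
  proof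
    have "bij_betw ((\<lambda>r. (r mod m, r div m)) \<circ> pick R) {..<card R} (syl_rows m d k)"
      using bij_betw_pick[OF fin] bij_betw_syl_rows[OF md, of k] R
      by (intro bij_betw_trans) (auto simp: R_def)
    then show "bij_betw (\<lambda>r. (pick R r mod m, pick R r div m)) {..<k * m + sum_list d} (syl_rows m d k)"
      by (simp add: card comp_def)
  next
    fix r s assume r: "r < k * m + sum_list d" and s: "s < k * (m + n)"
    have p: "pick R r \<in> R" using r card by (intro pick_in_set_le) simp
    have lt: "pick R r mod m < m" "s mod (m + n) < m + n" using md by simp_all
    have z: "poly.coeff (M $$ (pick R r mod m, s mod (m + n))) j = 0" if "\<not> j \<le> ?D" for j
      using polmat_coeff_eq_0[OF M lt] le[OF lt(1)] that by simp
    have mc: "mat_coeff M j $$ (pick R r mod m, s mod (m + n)) =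
        poly.coeff (M $$ (pick R r mod m, s mod (m + n))) j" for j
      using lt M unfolding mat_coeff_def by (subst index_map_mat(1)) (auto simp: polmat_space_def)
    have "trimmed_sylvester m n d k M $$ (r, s) = sylvester m n d k M $$ (pick R r, s)"
      unfolding trimmed_sylvester_def R_def[symmetric]
      using r s by (subst submatrix_index) (auto simp: sylvester_def R card pick_UNIV)
    also have "\<dots> = (if s div (m + n) \<le> pick R r div m \<and> pick R r div m - s div (m + n) \<le> ?D
        then mat_coeff M (pick R r div m - s div (m + n)) $$ (pick R r mod m, s mod (m + n)) else 0)"
      unfolding sylvester_def by (subst index_mat(1)[OF RN[OF p] s]) (simp add: Let_def)
    also have "\<dots> = syl_entry M (pick R r mod m, pick R r div m) (s mod (m + n), s div (m + n))"
      using z[of "pick R r div m - s div (m + n)"] by (simp only: mc syl_entry_def prod.case) metis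
    finally show "trimmed_sylvester m n d k M $$ (r, s) =
      syl_entry M (pick R r mod m, pick R r div m) (s mod (m + n), s div (m + n))" .
  qed
qed

section \<open>Injectivity and surjectivity of Sylvester maps and their dependence on
  \<open>k\<close>\<close>

definition right_inj :: "nat \<Rightarrow> nat \<Rightarrow> nat list \<Rightarrow> nat \<Rightarrow> 'a::field poly mat \<Rightarrow> bool" where
  "right_inj m n d k M \<longleftrightarrow> trivial_kernel (syl_rows m d k) (syl_cols m n k) (syl_entry M)"

text \<open>Surjectivity in dual form, as a trivial kernel of the transpose, so that both rank
  conditions share one determinantal criterion.\<close>

definition left_inj :: "nat \<Rightarrow> nat \<Rightarrow> nat list \<Rightarrow> nat \<Rightarrow> 'a::field poly mat \<Rightarrow> bool" where
  "left_inj m n d k M \<longleftrightarrow>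
     trivial_kernel (syl_cols m n k) (syl_rows m d k) (\<lambda>y x. syl_entry M x y)"

text \<open>There are at least as many rows as columns exactly when \<open>k * n\<close> is at most
  the degree sum; this decides whether the minimum asks for full column rank or full row
  rank.\<close>

lemma rank_trimmed_sylvester_iff:
  assumes md: "m > 0" "length d = m" and M: "M \<in> polmat_space m n d"
  shows "vec_space.rank (k * m + sum_list d) (trimmed_sylvester m n d k M)
      = min (k * m + sum_list d) (k * (m + n))
    \<longleftrightarrow> (if k * n \<le> sum_list d then right_inj m n d k M else left_inj m n d k M)"
proof -
  obtain f where f: "bij_betw f {..<k * m + sum_list d} (syl_rows m d k)"
    and T: "\<And>r s. r < k * m + sum_list d \<Longrightarrow> s < k * (m + n) \<Longrightarrow>
      trimmed_sylvester m n d k M $$ (r, s) = syl_entry M (f r) (s mod (m + n), s div (m + n))"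
    using trimmed_sylvester_entry[OF md M] by metis
  note carr = trimmed_sylvester_carrier[OF md, of n k M]
  note g = bij_betw_syl_cols[OF md(1), of n k]
  show ?thesis
  proof (cases "k * n \<le> sum_list d")
    case True
    then have "min (k * m + sum_list d) (k * (m + n)) = k * (m + n)" by (simp add: algebra_simps)
    with True show ?thesis
      using rank_eq_ncols_iff[OF carr] trivial_kernel_mat[OF carr f g, of "syl_entry M"] T
      by (simp add: right_inj_def)
  next
    case False
    then have "min (k * m + sum_list d) (k * (m + n)) = k * m + sum_list d" by (simp add: algebra_simps)
    with False show ?thesis
      using rank_eq_nrows_iff[OF carr] carr
        trivial_kernel_mat[of "transpose_mat (trimmed_sylvester m n d k M)", OF _ g f,
          of "\<lambda>y x. syl_entry M x y"] T
      by (simp add: left_inj_def)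
  qed
qed

lemma syl_entry_eq_0:
  assumes "M \<in> polmat_space m n d" "i < m" "c < m + n" "\<not> p < k + d ! i" "q < k"
  shows "syl_entry M (i, p) (c, q) = 0"
  using polmat_coeff_eq_0[OF assms(1-3), of "p - q"] assms(4,5) by (simp add: syl_entry_def)

text \<open>A kernel vector of degree below \<open>k\<close>, padded by zeros, is one of degree
  below \<open>l\<close>: the additional rows are not met by its columns.\<close>

lemma right_inj_antimono:
  assumes M: "M \<in> polmat_space m n d" and "k \<le> l" and r: "right_inj m n d l M"
  shows "right_inj m n d k M"
  unfolding right_inj_def trivial_kernel_def
proof (intro allI impI)
  fix v assume v: "\<forall>x\<in>syl_rows m d k. (\<Sum>y\<in>syl_cols m n k. syl_entry M x y * v y) = 0"
  define w where "w = (\<lambda>y. if y \<in> syl_cols m n k then v y else 0)"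
  have sub: "syl_cols m n k \<subseteq> syl_cols m n l" using \<open>k \<le> l\<close> by (auto simp: syl_cols_def)
  have fin: "finite (syl_cols m n l)" by (simp add: syl_cols_def)
  have "(\<Sum>y\<in>syl_cols m n l. syl_entry M x y * w y) = 0" if x: "x \<in> syl_rows m d l" for x
  proof -
    have "(\<Sum>y\<in>syl_cols m n l. syl_entry M x y * w y) = (\<Sum>y\<in>syl_cols m n k. syl_entry M x y * v y)"
      using fin sub by (intro sum.mono_neutral_cong_right) (auto simp: w_def)
    moreover have "(\<Sum>y\<in>syl_cols m n k. syl_entry M x y * v y) = 0"
    proof (cases "x \<in> syl_rows m d k")
      case False
      then have "syl_entry M x y = 0" if "y \<in> syl_cols m n k" for y
      proof -
        have "syl_entry M (fst x, snd x) (fst y, snd y) = 0"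
          using x that False by (intro syl_entry_eq_0[OF M]) (auto simp: syl_rows_def syl_cols_def)
        then show ?thesis by simp
      qed
      then show ?thesis by simp
    qed (use v in blast)
    ultimately show ?thesis by (rule trans)
  qed
  then have "\<forall>y\<in>syl_cols m n l. w y = 0"
    using trivial_kernelD[OF r[unfolded right_inj_def], of w] by blast
  then show "\<forall>y\<in>syl_cols m n k. v y = 0" using sub unfolding w_def by (metis subsetD)
qed

text \<open>Two copies of the smaller system sit inside the larger one, the second shifted by one
  power of \<lambda>. Each forces a window of entries of \<open>z\<close> to vanish, and the two
  windows cover everything.\<close>

lemma left_inj_Suc:
  assumes M: "M \<in> polmat_space m n d" and "k \<ge> 1" and l: "left_inj m n d k M"
  shows "left_inj m n d (Suc k) M"
  unfolding left_inj_def trivial_kernel_def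
proof (intro allI impI)
  fix z assume z: "\<forall>y\<in>syl_cols m n (Suc k). (\<Sum>x\<in>syl_rows m d (Suc k). syl_entry M x y * z x) = 0"
  have fin: "finite (syl_rows m d l)" for l by (simp add: syl_rows_def)
  have sub: "syl_rows m d k \<subseteq> syl_rows m d (Suc k)" by (auto simp: syl_rows_def)
  have "(\<Sum>x\<in>syl_rows m d k. syl_entry M x y * z x) = 0" if y: "y \<in> syl_cols m n k" for y
  proof -
    have "(\<Sum>x\<in>syl_rows m d k. syl_entry M x y * z x) = (\<Sum>x\<in>syl_rows m d (Suc k). syl_entry M x y * z x)"
    proof (rule sum.mono_neutral_left[OF fin sub], rule ballI)
      fix x assume "x \<in> syl_rows m d (Suc k) - syl_rows m d k"
      then have "syl_entry M (fst x, snd x) (fst y, snd y) = 0"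
        using y by (intro syl_entry_eq_0[OF M]) (auto simp: syl_rows_def syl_cols_def)
      then show "syl_entry M x y * z x = 0" by simp
    qed
    then show ?thesis using z y by (auto simp: syl_cols_def)
  qed
  then have z0: "z x = 0" if "x \<in> syl_rows m d k" for x
    using trivial_kernelD[OF l[unfolded left_inj_def], of z] that by blast
  let ?s = "\<lambda>(i, p). (i, Suc p)"
  have "(\<Sum>x\<in>syl_rows m d k. syl_entry M x y * z (?s x)) = 0" if y: "y \<in> syl_cols m n k" for y
  proof -
    \<comment> \<open>Shifting row and column powers together preserves entries, by the block
      Toeplitz structure.\<close>
    have "(\<Sum>x\<in>syl_rows m d k. syl_entry M x y * z (?s x))
        = (\<Sum>x\<in>syl_rows m d k. syl_entry M (?s x) (?s y) * z (?s x))"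
      by (intro sum.cong) (auto simp: syl_entry_def split: prod.splits)
    also have "\<dots> = (\<Sum>x\<in>?s ` syl_rows m d k. syl_entry M x (?s y) * z x)"
      by (subst sum.reindex) (auto intro!: inj_onI)
    also have "\<dots> = (\<Sum>x\<in>syl_rows m d (Suc k). syl_entry M x (?s y) * z x)"
    proof (intro sum.mono_neutral_left fin ballI)
      show "?s ` syl_rows m d k \<subseteq> syl_rows m d (Suc k)" by (auto simp: syl_rows_def)
      fix x assume "x \<in> syl_rows m d (Suc k) - ?s ` syl_rows m d k"
      \<comment> \<open>The rows missed by the shift have power 0, and a shifted column does not
        reach them.\<close>
      then have "snd x = 0" by (cases x; cases "snd x") (force simp: syl_rows_def)+
      then show "syl_entry M x (?s y) * z x = 0" by (auto simp: syl_entry_def split: prod.splits)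
    qed
    also have "\<dots> = 0" using y by (intro z[rule_format]) (auto simp: syl_cols_def)
    finally show ?thesis .
  qed
  then have "\<forall>x\<in>syl_rows m d k. z (?s x) = 0"
    using trivial_kernelD[OF l[unfolded left_inj_def], of "\<lambda>x. z (?s x)"] by blast
  then have z1: "z (i, Suc p) = 0" if "(i, p) \<in> syl_rows m d k" for i p
    using that by force
  show "\<forall>x\<in>syl_rows m d (Suc k). z x = 0"
  proof clarify
    fix i p assume "(i, p) \<in> syl_rows m d (Suc k)"
    \<comment> \<open>Power 0 falls into the unshifted window; for \<open>d ! i = 0\<close> this
      needs \<open>k \<ge> 1\<close>.\<close>
    then show "z (i, p) = 0" using z0 z1 \<open>k \<ge> 1\<close> by (cases p) (auto simp: syl_rows_def)
  qed
qed

lemma TSyl_iff: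
  assumes md: "m > 0" "n > 0" "length d = m" and M: "M \<in> polmat_space m n d"
  shows "M \<in> TSyl m n d \<longleftrightarrow>
    right_inj m n d (sum_list d div n) M \<and> left_inj m n d (Suc (sum_list d div n)) M"
proof -
  let ?a = "sum_list d" and ?k = "sum_list d div n"
  have le: "k * n \<le> ?a \<longleftrightarrow> k \<le> ?k" for k
    using \<open>n > 0\<close> by (simp add: less_eq_div_iff_mult_less_eq)
  have "M \<in> TSyl m n d \<longleftrightarrow>
      (\<forall>k\<ge>1. if k \<le> ?k then right_inj m n d k M else left_inj m n d k M)"
    using M rank_trimmed_sylvester_iff[OF md(1,3) M]
    by (simp add: TSyl_def full_trimmed_sylvester_rank_def le)
  also have "\<dots> \<longleftrightarrow> right_inj m n d ?k M \<and> left_inj m n d (Suc ?k) M"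
  proof
    assume all: "\<forall>k\<ge>1. if k \<le> ?k then right_inj m n d k M else left_inj m n d k M"
    have "right_inj m n d ?k M"
    \<comment> \<open>The rank conditions start at \<open>k = 1\<close>; for \<open>?k = 0\<close>
      there are no columns and injectivity is vacuous.\<close>
    proof (cases "?k = 0")
      case True
      then show ?thesis by (simp add: right_inj_def trivial_kernel_def syl_cols_def)
    next
      case False
      then show ?thesis using all[rule_format, of ?k] by simp
    qed
    then show "right_inj m n d ?k M \<and> left_inj m n d (Suc ?k) M" using all[rule_format, of "Suc ?k"] by simp
  next
    assume rl: "right_inj m n d ?k M \<and> left_inj m n d (Suc ?k) M"
    have "left_inj m n d k M" if "Suc ?k \<le> k" for k
      using that by (induction k rule: dec_induct) (use rl left_inj_Suc[OF M] in auto)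
    then show "\<forall>k\<ge>1. if k \<le> ?k then right_inj m n d k M else left_inj m n d k M"
      using rl right_inj_antimono[OF M] by auto
  qed
  finally show ?thesis .
qed

section \<open>A matrix of full trimmed Sylvester rank\<close>

text \<open>Lay the rows of the matrix out on the line \<open>[0, a]\<close>, row \<open>i\<close> occupying an interval of length
  \<open>d ! i\<close>. A column placed at position \<open>x\<close> has the entry \<open>\<lambda>\<close> to the power \<open>x - row_pos d i\<close> (up to
  sign) in each row \<open>i\<close> it meets. There is one column at every boundary between consecutive rows,
  meeting both of them, and there are \<open>n + 1\<close> evenly spread kernel columns, each
  meeting a single row. Multiplying row \<open>i\<close> by \<open>\<lambda>\<close> to the power \<open>row_pos d i\<close> decouples the linear
  system by position.\<close>

definition row_pos :: "nat list \<Rightarrow> nat \<Rightarrow> nat" where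
  "row_pos d i = (\<Sum>l<i. d ! l)"

definition ker_pos :: "nat \<Rightarrow> nat list \<Rightarrow> nat \<Rightarrow> nat" where
  "ker_pos n d j = j * sum_list d div n"

lemma row_pos_Suc: "row_pos d (Suc i) = row_pos d i + d ! i"
  by (simp add: row_pos_def)

lemma row_pos_mono: "i \<le> j \<Longrightarrow> row_pos d i \<le> row_pos d j"
  unfolding row_pos_def by (intro sum_mono2) auto

lemma row_pos_length: "row_pos d (length d) = sum_list d"
  by (simp add: row_pos_def sum_list_sum_nth atLeast0LessThan)

lemma row_pos_interval:
  assumes "y \<le> row_pos d (Suc l)"
  shows "\<exists>i\<le>l. row_pos d i \<le> y \<and> y \<le> row_pos d (Suc i)"
  using assms
proof (induction l)
  case 0
  then show ?case by (simp add: row_pos_def)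
next
  case (Suc l)
  show ?case
  proof (cases "y \<le> row_pos d (Suc l)")
    case True
    then show ?thesis using Suc.IH le_SucI by blast
  next
    case False
    then show ?thesis using Suc.prems by (intro exI[of _ "Suc l"]) simp
  qed
qed

text \<open>Adding the multiple \<open>k * n\<close> of \<open>n\<close> before rounding down shifts
  the quotient by exactly \<open>k\<close>, so the bound on the real gap survives rounding.\<close>

lemma ker_pos_gap_ge:
  assumes "n > 0" "k * n \<le> sum_list d" "i < j"
  shows "ker_pos n d i + k \<le> ker_pos n d j"
proof -
  have "i * sum_list d + k * n \<le> Suc i * sum_list d" using assms by simp
  also have "\<dots> \<le> j * sum_list d" using assms by (intro mult_le_mono1) simp
  finally have "(i * sum_list d + k * n) div n \<le> j * sum_list d div n" by (rule div_le_mono)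
  then show ?thesis using \<open>n > 0\<close> by (simp add: ker_pos_def)
qed

lemma ker_pos_gap_le:
  assumes "n > 0" "sum_list d \<le> k * n"
  shows "ker_pos n d (Suc j) \<le> ker_pos n d j + k"
proof -
  have "Suc j * sum_list d \<le> j * sum_list d + k * n" using assms by simp
  then have "Suc j * sum_list d div n \<le> (j * sum_list d + k * n) div n" by (rule div_le_mono)
  then show ?thesis using \<open>n > 0\<close> by (simp add: ker_pos_def)
qed

text \<open>The windows of length \<open>k\<close> start at 0, advance by at most \<open>k\<close>
  and end at the degree sum plus \<open>k\<close>, so they leave no hole.\<close>

lemma ker_pos_cover:
  assumes n: "n > 0" "sum_list d \<le> k * n" and P: "P < sum_list d + k"
  shows "\<exists>j\<le>n. ker_pos n d j \<le> P \<and> P < ker_pos n d j + k"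
proof -
  have "\<exists>j\<le>l. ker_pos n d j \<le> P \<and> P < ker_pos n d j + k" if "P < ker_pos n d l + k" for l
    using that
  proof (induction l)
    case 0
    then show ?case by (simp add: ker_pos_def)
  next
    case (Suc l)
    show ?case
    proof (cases "ker_pos n d (Suc l) \<le> P")
      case True
      then show ?thesis using Suc.prems by blast
    next
      case False
      then have "P < ker_pos n d l + k" using ker_pos_gap_le[OF n, of l] by linarith
      then show ?thesis using Suc.IH le_SucI by blast
    qed
  qed
  from this[of n] show ?thesis using P n by (simp add: ker_pos_def)
qed

text \<open>\<open>\<rho> j\<close> is a row whose interval contains the \<open>j\<close>th kernel
  position. At a boundary several rows qualify, and any choice will do.\<close>

locale zigzag =
  fixes m n :: nat and d :: "nat list" and \<rho> :: "nat \<Rightarrow> nat"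
  assumes m: "m > 0" and n: "n > 0" and d: "length d = m"
    and \<rho>: "\<And>j. j \<le> n \<Longrightarrow> \<rho> j < m"
    and \<rho>_le: "\<And>j. j \<le> n \<Longrightarrow> row_pos d (\<rho> j) \<le> ker_pos n d j"
    and \<rho>_ge: "\<And>j. j \<le> n \<Longrightarrow> ker_pos n d j \<le> row_pos d (Suc (\<rho> j))"
begin

definition col_pos :: "nat \<Rightarrow> nat" where
  "col_pos c = (if c < m - 1 then row_pos d (Suc c) else ker_pos n d (c - (m - 1)))"

text \<open>The opposite signs make the two entries of a boundary column cancel when all rows are
  added.\<close>

definition sig :: "nat \<Rightarrow> nat \<Rightarrow> 'a::field" where
  "sig i c = (if c < m - 1 then (if i = c then 1 else if i = Suc c then - 1 else 0)
     else if i = \<rho> (c - (m - 1)) then 1 else 0)"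

definition zmat :: "'a::field poly mat" where
  "zmat = mat m (m + n) (\<lambda>(i, c). Polynomial.monom (sig i c) (col_pos c - row_pos d i))"

text \<open>The lower bound makes the truncated exponent in \<open>zmat\<close> exact; the upper
  bound keeps the degree within \<open>d ! i\<close>.\<close>

lemma sig_pos:
  assumes "i < m" "c < m + n" "sig i c \<noteq> (0 :: 'a::field)"
  shows "row_pos d i \<le> col_pos c \<and> col_pos c \<le> row_pos d (Suc i)"
proof (cases "c < m - 1")
  case True
  then have "i = c \<or> i = Suc c" using assms(3) by (auto simp: sig_def split: if_splits)
  then show ?thesis using True by (auto simp: col_pos_def intro: row_pos_mono)
next
  case False
  then have "i = \<rho> (c - (m - 1))" "c - (m - 1) \<le> n"
    using assms by (auto simp: sig_def split: if_splits)
  then show ?thesis using False \<rho>_le \<rho>_ge by (simp add: col_pos_def)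
qed

lemma zmat_space: "(zmat :: 'a::field poly mat) \<in> polmat_space m n d"
proof -
  have "degree (Polynomial.monom (sig i c :: 'a) (col_pos c - row_pos d i)) \<le> d ! i"
    if "i < m" "c < m + n" for i c
  proof (cases "sig i c = (0 :: 'a)")
    case False
    have "degree (Polynomial.monom (sig i c :: 'a) (col_pos c - row_pos d i)) \<le> col_pos c - row_pos d i"
      by (rule degree_monom_le)
    also have "\<dots> \<le> d ! i" using sig_pos[OF that False] unfolding row_pos_Suc by linarith
    finally show ?thesis .
  qed simp
  then show ?thesis by (simp add: polmat_space_def zmat_def)
qed

text \<open>Row and column entries interact only at a common position
  \<open>P = p + row_pos d i = q + col_pos c\<close>, so the system splits into one system with
  coefficients \<open>sig\<close> for each \<open>P\<close>.\<close>

lemma syl_entry_zmat: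
  assumes "i < m" "c < m + n"
  shows "syl_entry zmat (i, p) (c, q) = (if p + row_pos d i = q + col_pos c then sig i c else (0 :: 'a::field))"
proof (cases "sig i c = (0 :: 'a)")
  case True
  then show ?thesis using assms by (simp add: syl_entry_def zmat_def)
next
  case False
  have "syl_entry zmat (i, p) (c, q) = (if q \<le> p \<and> p - q = col_pos c - row_pos d i then sig i c else (0 :: 'a))"
    using assms by (auto simp: syl_entry_def zmat_def)
  moreover have "q \<le> p \<and> p - q = col_pos c - row_pos d i \<longleftrightarrow> p + row_pos d i = q + col_pos c"
    using sig_pos[OF assms False] by linarith
  ultimately show ?thesis by simp
qed

lemma right_inj_zmat:
  assumes k: "k * n \<le> sum_list d"
  shows "right_inj m n d k (zmat :: 'a::field poly mat)"
  unfolding right_inj_def trivial_kernel_def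
proof (intro allI impI)
  fix v :: "nat \<times> nat \<Rightarrow> 'a"
  assume v: "\<forall>x\<in>syl_rows m d k. (\<Sum>y\<in>syl_cols m n k. syl_entry zmat x y * v y) = 0"
  \<comment> \<open>Component \<open>c\<close> of \<open>v\<close>, moved to absolute positions and
    zero outside its window of length \<open>k\<close>.\<close>
  define u where "u = (\<lambda>c P. if col_pos c \<le> P \<and> P < col_pos c + k then v (c, P - col_pos c) else 0)"
  have row: "(\<Sum>c<m + n. sig i c * u c P) = 0" if i: "i < m" for i P
  proof (cases "row_pos d i \<le> P \<and> P < row_pos d (Suc i) + k")
    case True
    let ?p = "P - row_pos d i"
    have "(\<Sum>c<m + n. sig i c * u c P) = (\<Sum>c<m + n. \<Sum>q<k. syl_entry zmat (i, ?p) (c, q) * v (c, q))"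
    proof (rule sum.cong[OF refl])
      fix c assume c: "c \<in> {..<m + n}"
      have "(\<Sum>q<k. syl_entry zmat (i, ?p) (c, q) * v (c, q))
          = (\<Sum>q<k. if q = P - col_pos c then (if col_pos c \<le> P then sig i c * v (c, q) else 0) else 0)"
        using c i True by (intro sum.cong refl) (auto simp: syl_entry_zmat)
      also have "\<dots> = sig i c * u c P" by (auto simp: u_def)
      finally show "sig i c * u c P = (\<Sum>q<k. syl_entry zmat (i, ?p) (c, q) * v (c, q))" by simp
    qed
    also have "\<dots> = (\<Sum>y\<in>syl_cols m n k. syl_entry zmat (i, ?p) y * v y)"
      by (simp add: syl_cols_def sum.cartesian_product split_def)
    also have "\<dots> = 0" using v i True by (simp add: syl_rows_def row_pos_Suc less_diff_conv2)
    finally show ?thesis .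
  next
    case False
    \<comment> \<open>Every column meeting row \<open>i\<close> has its window inside that of the
      row, so it contributes nothing at this \<open>P\<close>.\<close>
    then have "sig i c * u c P = 0" if "c < m + n" for c
      using sig_pos[OF i that, where 'a = 'a] by (cases "sig i c = (0 :: 'a)") (auto simp: u_def)
    then show ?thesis by (intro sum.neutral) auto
  qed
  have col: "(\<Sum>i<m. sig i c) = (if c < m - 1 then 0 else (1 :: 'a))" if c: "c < m + n" for c
  proof (cases "c < m - 1")
    case True
    have "(\<Sum>i<m. sig i c) = (\<Sum>i<m. (if i = c then 1 else 0) - (if i = Suc c then 1 else (0 :: 'a)))"
      using True by (intro sum.cong) (auto simp: sig_def)
    then show ?thesis using True by (simp add: sum_subtractf)
  next
    case False
    define r where "r = \<rho> (c - (m - 1))"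
    have "r < m" unfolding r_def using False c by (intro \<rho>) simp
    moreover have "(\<Sum>i<m. sig i c) = (\<Sum>i<m. if i = r then 1 else (0 :: 'a))"
      using False by (intro sum.cong) (auto simp: sig_def r_def)
    ultimately show ?thesis using False by simp
  qed
  \<comment> \<open>Summing all rows, the boundary columns telescope and only the kernel columns are left;
    their supports are disjoint because consecutive kernel positions differ by at least \<open>k\<close>.\<close>
  have ker: "u c P = 0" if c: "m - 1 \<le> c" "c < m + n" for c P
  proof (rule ccontr)
    assume nz: "u c P \<noteq> 0"
    have other: "u c' P = 0" if c': "m - 1 \<le> c'" "c' < m + n" "c' \<noteq> c" for c'
    proof -
      have "col_pos c + k \<le> col_pos c' \<or> col_pos c' + k \<le> col_pos c"
        using ker_pos_gap_ge[OF n k, of "c - (m - 1)" "c' - (m - 1)"]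
          ker_pos_gap_ge[OF n k, of "c' - (m - 1)" "c - (m - 1)"] c c'
        by (cases "c < c'") (auto simp: col_pos_def)
      then show ?thesis using nz by (auto simp: u_def split: if_splits)
    qed
    have "0 = (\<Sum>i<m. \<Sum>c'<m + n. sig i c' * u c' P)" using row by simp
    also have "\<dots> = (\<Sum>c'<m + n. (\<Sum>i<m. sig i c') * u c' P)"
      by (subst sum.swap) (simp add: sum_distrib_right)
    also have "\<dots> = (\<Sum>c'\<in>{c}. u c' P)"
      using c col other by (intro sum.mono_neutral_cong_right) auto
    finally show False using nz by simp
  qed
  \<comment> \<open>Among the boundary columns, row \<open>c\<close> meets only \<open>c - 1\<close>
    and \<open>c\<close>, so they vanish one after another from the left.\<close>
  have bd: "u c P = 0" if "c < m - 1" for c P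
    using that
  proof (induction c rule: less_induct)
    case (less c)
    have "sig c c' * u c' P = 0" if "c' < m + n" "c' \<noteq> c" for c'
    proof (cases "c' < m - 1")
      case True
      then show ?thesis using less that by (auto simp: sig_def)
    qed (use ker that in auto)
    then have "(\<Sum>c'<m + n. sig c c' * u c' P) = (\<Sum>c'\<in>{c}. sig c c' * u c' P)"
      using less.prems by (intro sum.mono_neutral_right) auto
    then show ?case using row[of c P] less.prems by (simp add: sig_def)
  qed
  show "\<forall>y\<in>syl_cols m n k. v y = 0"
  proof clarify
    fix c q assume "(c, q) \<in> syl_cols m n k"
    then have c: "c < m + n" "q < k" by (simp_all add: syl_cols_def)
    then have "u c (col_pos c + q) = 0" using ker bd by (cases "c < m - 1") simp_all
    then show "v (c, q) = 0" using c by (simp add: u_def)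
  qed
qed

text \<open>Dually, a boundary column equates the entries of two neighbouring rows at a position,
  and a kernel column makes an entry of its row vanish, each on a window of length
  \<open>k\<close>.\<close>

lemma left_inj_zmat:
  assumes k: "sum_list d \<le> k * n"
  shows "left_inj m n d k (zmat :: 'a::field poly mat)"
  unfolding left_inj_def trivial_kernel_def
proof (intro allI impI)
  fix z :: "nat \<times> nat \<Rightarrow> 'a"
  assume z: "\<forall>y\<in>syl_cols m n k. (\<Sum>x\<in>syl_rows m d k. syl_entry zmat x y * z x) = 0"
  \<comment> \<open>For \<open>P\<close> below \<open>row_pos d i\<close> the value is spurious, but
    then \<open>sig\<close> is zero in the column equations.\<close>
  define Z where "Z = (\<lambda>i P. z (i, P - row_pos d i))"
  have col: "(\<Sum>i<m. sig i c * Z i (q + col_pos c)) = 0" if c: "c < m + n" "q < k" for c q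
  proof -
    have "(\<Sum>i<m. sig i c * Z i (q + col_pos c))
        = (\<Sum>i<m. \<Sum>p<k + d ! i. syl_entry zmat (i, p) (c, q) * z (i, p))"
    proof (rule sum.cong[OF refl])
      fix i assume "i \<in> {..<m}"
      then have i: "i < m" by simp
      show "sig i c * Z i (q + col_pos c) = (\<Sum>p<k + d ! i. syl_entry zmat (i, p) (c, q) * z (i, p))"
      proof (cases "sig i c = (0 :: 'a)")
        case True
        then show ?thesis using i c by (simp add: syl_entry_zmat)
      next
        case False
        note pos = sig_pos[OF i c(1) False]
        have "(\<Sum>p<k + d ! i. syl_entry zmat (i, p) (c, q) * z (i, p))
            = (\<Sum>p<k + d ! i. if p = q + col_pos c - row_pos d i then sig i c * z (i, p) else 0)"
          using pos i c by (intro sum.cong refl) (auto simp: syl_entry_zmat)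
        also have "\<dots> = sig i c * Z i (q + col_pos c)"
          using pos c by (simp add: Z_def row_pos_Suc) linarith
        finally show ?thesis by simp
      qed
    qed
    also have "\<dots> = (\<Sum>x\<in>syl_rows m d k. syl_entry zmat x (c, q) * z x)"
      by (simp add: syl_rows_def sum.Sigma split_def)
    also have "\<dots> = 0" using z c by (simp add: syl_cols_def)
    finally show ?thesis .
  qed
  have bd: "Z i P = Z (Suc i) P" if i: "Suc i < m" and P: "row_pos d (Suc i) \<le> P" "P < row_pos d (Suc i) + k" for i P
  proof -
    have "(\<Sum>l<m. sig l i * Z l P) = (\<Sum>l<m. (if l = i then Z l P else 0) - (if l = Suc i then Z l P else 0))"
      using i by (intro sum.cong) (auto simp: sig_def)
    also have "\<dots> = Z i P - Z (Suc i) P" using i by (simp add: sum_subtractf)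
    finally have "(\<Sum>l<m. sig l i * Z l P) = Z i P - Z (Suc i) P" .
    moreover have "i < m - 1" using i by linarith
    then have "col_pos i = row_pos d (Suc i)" by (simp add: col_pos_def)
    ultimately show ?thesis using col[of i "P - row_pos d (Suc i)"] i P by simp
  qed
  have ker: "Z (\<rho> j) P = 0" if j: "j \<le> n" and P: "ker_pos n d j \<le> P" "P < ker_pos n d j + k" for j P
  proof -
    have "(\<Sum>l<m. sig l (m - 1 + j) * Z l P) = (\<Sum>l<m. if l = \<rho> j then Z l P else 0)"
      by (intro sum.cong) (auto simp: sig_def)
    also have "\<dots> = Z (\<rho> j) P" using \<rho>[OF j] by simp
    finally have "(\<Sum>l<m. sig l (m - 1 + j) * Z l P) = Z (\<rho> j) P" .
    moreover have "col_pos (m - 1 + j) = ker_pos n d j" by (simp add: col_pos_def)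
    ultimately show ?thesis using col[of "m - 1 + j" "P - ker_pos n d j"] m j P by simp
  qed
  \<comment> \<open>Some kernel position lies in the window of length \<open>k\<close> ending at \<open>P\<close>; the boundary columns
    transport the entry at \<open>P\<close> to the row of that kernel column.\<close>
  have zero: "Z i P = 0" if i: "i < m" and P: "row_pos d i \<le> P" "P < row_pos d (Suc i) + k" for i P
  proof -
    have "row_pos d (Suc i) \<le> sum_list d"
      using row_pos_mono[of "Suc i" m d] i d row_pos_length[of d] by simp
    then obtain j where j: "j \<le> n" "ker_pos n d j \<le> P" "P < ker_pos n d j + k"
      using ker_pos_cover[OF n k, of P] P by auto
    note r = \<rho>[OF j(1)] \<rho>_le[OF j(1)] \<rho>_ge[OF j(1)]
    show ?thesis
    proof (cases "i \<le> \<rho> j")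
      case True
      have "l \<le> \<rho> j \<Longrightarrow> Z i P = Z l P" if "i \<le> l" for l
        using that
      proof (induction l rule: dec_induct)
        case (step l)
        \<comment> \<open>Each boundary crossed is at most \<open>P\<close>, as it precedes the
          kernel position, and less than \<open>k\<close> before \<open>P\<close>, as it is not
          before the end of row \<open>i\<close>. The other case exchanges the roles of row
          \<open>i\<close> and the kernel position.\<close>
        have "row_pos d (Suc l) \<le> row_pos d (\<rho> j)" "row_pos d (Suc i) \<le> row_pos d (Suc l)"
          using step by (auto intro: row_pos_mono)
        then have "Z l P = Z (Suc l) P" using step r j P by (intro bd) auto
        then show ?case using step by simp
      qed simp
      from this[OF True] show ?thesis using ker[OF j] by simp
    next
      case False
      have "l \<le> i \<Longrightarrow> Z l P = Z (\<rho> j) P" if "\<rho> j \<le> l" for l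
        using that
      proof (induction l rule: dec_induct)
        case (step l)
        have "row_pos d (Suc l) \<le> row_pos d i" "row_pos d (Suc (\<rho> j)) \<le> row_pos d (Suc l)"
          using step by (auto intro: row_pos_mono)
        then have "Z l P = Z (Suc l) P" using step r j P i by (intro bd) auto
        then show ?case using step by simp
      qed simp
      from this[of i] show ?thesis using False ker[OF j] by simp
    qed
  qed
  show "\<forall>x\<in>syl_rows m d k. z x = 0"
  proof clarify
    fix i p assume "(i, p) \<in> syl_rows m d k"
    then show "z (i, p) = 0"
      using zero[of i "row_pos d i + p"] by (simp add: syl_rows_def Z_def row_pos_Suc)
  qed
qed

end

lemma exists_right_left_inj:
  assumes m: "m > 0" and n: "n > 0" and d: "length d = m"
  obtains M :: "'a::field poly mat" where "M \<in> polmat_space m n d"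
    and "\<And>k. k * n \<le> sum_list d \<Longrightarrow> right_inj m n d k M"
    and "\<And>k. sum_list d \<le> k * n \<Longrightarrow> left_inj m n d k M"
proof -
  have "\<exists>i<m. row_pos d i \<le> ker_pos n d j \<and> ker_pos n d j \<le> row_pos d (Suc i)" if j: "j \<le> n" for j
  proof -
    have "j * sum_list d div n \<le> n * sum_list d div n" using j by (intro div_le_mono mult_le_mono1)
    then have "ker_pos n d j \<le> row_pos d (Suc (m - 1))"
      using n m d row_pos_length[of d] by (simp add: ker_pos_def)
    from row_pos_interval[OF this] show ?thesis using m by (metis Suc_pred' less_Suc_eq_le)
  qed
  then obtain \<rho> where "\<And>j. j \<le> n \<Longrightarrow>
      \<rho> j < m \<and> row_pos d (\<rho> j) \<le> ker_pos n d j \<and> ker_pos n d j \<le> row_pos d (Suc (\<rho> j))"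
    by metis
  then interpret zigzag m n d \<rho> using assms by unfold_locales auto
  show ?thesis using that[OF zmat_space right_inj_zmat left_inj_zmat] by blast
qed

section \<open>Polynomial functions of the coefficients\<close>

definition mono_eval :: "(nat \<Rightarrow>\<^sub>0 nat) \<Rightarrow> 'a::comm_ring_1 vec \<Rightarrow> 'a" where
  "mono_eval u x = (\<Prod>i\<in>Poly_Mapping.keys u. (x $ i) ^ Poly_Mapping.lookup u i)"

lemma mpoly_eval_mono: "mpoly_eval f x = (\<Sum>u\<in>Poly_Mapping.keys f. Poly_Mapping.lookup f u * mono_eval u x)"
  by (simp add: mpoly_eval_def mono_eval_def)

lemma mono_eval_superset:
  assumes "finite S" "Poly_Mapping.keys u \<subseteq> S"
  shows "mono_eval u x = (\<Prod>i\<in>S. (x $ i) ^ Poly_Mapping.lookup u i)"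
  unfolding mono_eval_def using assms
  by (intro prod.mono_neutral_left) (auto simp: in_keys_iff)

lemma mono_eval_add: "mono_eval (u + v) x = mono_eval u x * mono_eval v x"
proof -
  let ?S = "Poly_Mapping.keys u \<union> Poly_Mapping.keys v"
  have "mono_eval (u + v) x = (\<Prod>i\<in>?S. (x $ i) ^ Poly_Mapping.lookup (u + v) i)"
    using keys_add[of u v] by (intro mono_eval_superset) auto
  also have "\<dots> = (\<Prod>i\<in>?S. (x $ i) ^ Poly_Mapping.lookup u i) * (\<Prod>i\<in>?S. (x $ i) ^ Poly_Mapping.lookup v i)"
    by (simp add: lookup_add power_add prod.distrib)
  finally show ?thesis by (simp add: mono_eval_superset[of ?S])
qed

lemma mpoly_eval_add: "mpoly_eval (f + g) x = mpoly_eval f x + mpoly_eval g x"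
  unfolding mpoly_eval_mono
  by (rule setsum_keys_plus_distrib) (auto simp: algebra_simps)

lemma mpoly_eval_sum: "mpoly_eval (\<Sum>i\<in>I. f i) x = (\<Sum>i\<in>I. mpoly_eval (f i) x)"
proof (induction I rule: infinite_finite_induct)
  case (insert i I)
  then show ?case by (simp add: mpoly_eval_add)
qed (simp_all add: mpoly_eval_def)

lemma mpoly_eval_single: "mpoly_eval (Poly_Mapping.single u a) x = a * mono_eval u x"
  by (simp add: mpoly_eval_mono)

lemma poly_mapping_sum_single:
  fixes f :: "'b \<Rightarrow>\<^sub>0 'a::comm_monoid_add"
  shows "f = (\<Sum>u\<in>Poly_Mapping.keys f. Poly_Mapping.single u (Poly_Mapping.lookup f u))"
  by (rule poly_mapping_eqI)
    (simp add: lookup_sum lookup_single when_def in_keys_iff)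

lemma mpoly_eval_mult: "mpoly_eval (f * g) x = mpoly_eval f x * mpoly_eval g x"
proof -
  have "f * g = (\<Sum>u\<in>Poly_Mapping.keys f. \<Sum>v\<in>Poly_Mapping.keys g.
      Poly_Mapping.single (u + v) (Poly_Mapping.lookup f u * Poly_Mapping.lookup g v))"
    by (subst poly_mapping_sum_single[of f], subst poly_mapping_sum_single[of g])
      (simp add: sum_product mult_single)
  then have "mpoly_eval (f * g) x = (\<Sum>u\<in>Poly_Mapping.keys f. \<Sum>v\<in>Poly_Mapping.keys g.
      (Poly_Mapping.lookup f u * Poly_Mapping.lookup g v) * mono_eval (u + v) x)"
    by (simp add: mpoly_eval_sum mpoly_eval_single)
  also have "\<dots> = mpoly_eval f x * mpoly_eval g x"
    by (simp add: mpoly_eval_mono sum_product mono_eval_add mult_ac)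
  finally show ?thesis .
qed

lemma mpolys_in_add: "f \<in> mpolys_in N \<Longrightarrow> g \<in> mpolys_in N \<Longrightarrow> f + g \<in> mpolys_in N"
  unfolding mpolys_in_def using keys_add[of f g] by blast

lemma mpolys_in_mult:
  assumes "f \<in> mpolys_in N" "g \<in> mpolys_in N"
  shows "f * g \<in> mpolys_in N"
  unfolding mpolys_in_def
proof (intro CollectI ballI subsetI)
  fix w i assume w: "w \<in> Poly_Mapping.keys (f * g)" and i: "i \<in> Poly_Mapping.keys w"
  obtain u v where "u \<in> Poly_Mapping.keys f" "v \<in> Poly_Mapping.keys g" "w = u + v"
    using keys_mult[of f g] w by blast
  then show "i \<in> {..<N}" using assms i keys_add[of u v] unfolding mpolys_in_def by blast
qed

lemma mpoly_const: "Poly_Mapping.single 0 a \<in> mpolys_in N" "mpoly_eval (Poly_Mapping.single 0 a) x = a"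
  by (simp_all add: mpolys_in_def mpoly_eval_def)

lemma mpoly_var:
  assumes "i < N"
  shows "Poly_Mapping.single (Poly_Mapping.single i 1) 1 \<in> mpolys_in N"
    and "mpoly_eval (Poly_Mapping.single (Poly_Mapping.single i 1) 1) x = x $ i"
  using assms by (auto simp: mpolys_in_def mpoly_eval_def)

text \<open>Polynomial functions are generated by closure rules, so that representation by a
  polynomial, restriction to a line and continuity all follow by induction. \<open>Basis\<close>
  supplies the real coordinates, that is, real and imaginary parts in the complex case.\<close>

inductive_set coeff_polyfuns :: "nat \<Rightarrow> nat \<Rightarrow> ('a::{field,euclidean_space} poly mat \<Rightarrow> real) set"
  for m n where
  const: "(\<lambda>M. a) \<in> coeff_polyfuns m n"
| coeff: "i < m \<Longrightarrow> c < m + n \<Longrightarrow> b \<in> Basis \<Longrightarrow>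
    (\<lambda>M. inner (poly.coeff (M $$ (i, c)) j) b) \<in> coeff_polyfuns m n"
| add: "f \<in> coeff_polyfuns m n \<Longrightarrow> g \<in> coeff_polyfuns m n \<Longrightarrow> (\<lambda>M. f M + g M) \<in> coeff_polyfuns m n"
| mult: "f \<in> coeff_polyfuns m n \<Longrightarrow> g \<in> coeff_polyfuns m n \<Longrightarrow> (\<lambda>M. f M * g M) \<in> coeff_polyfuns m n"

lemma coeff_polyfuns_sum:
  "(\<And>x. x \<in> S \<Longrightarrow> f x \<in> coeff_polyfuns m n) \<Longrightarrow> (\<lambda>M. \<Sum>x\<in>S. f x M) \<in> coeff_polyfuns m n"
  by (induction S rule: infinite_finite_induct) (auto intro: coeff_polyfuns.intros)

text \<open>Polynomiality is demanded of the real coordinates because conjugation must stay inside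
  the class.\<close>

definition coeff_polymaps ::
    "nat \<Rightarrow> nat \<Rightarrow> ('a::{field,euclidean_space} poly mat \<Rightarrow> 'a) set" where
  "coeff_polymaps m n = {f. \<forall>b\<in>Basis. (\<lambda>M. inner (f M) b) \<in> coeff_polyfuns m n}"

lemma coeff_polymaps_const: "(\<lambda>M. a) \<in> coeff_polymaps m n"
  by (simp add: coeff_polymaps_def coeff_polyfuns.const)

lemma coeff_polymaps_coeff:
  "i < m \<Longrightarrow> c < m + n \<Longrightarrow> (\<lambda>M. poly.coeff (M $$ (i, c)) j) \<in> coeff_polymaps m n"
  by (simp add: coeff_polymaps_def coeff_polyfuns.coeff)

lemma coeff_polymaps_add:
  "f \<in> coeff_polymaps m n \<Longrightarrow> g \<in> coeff_polymaps m n \<Longrightarrow> (\<lambda>M. f M + g M) \<in> coeff_polymaps m n"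
  by (simp add: coeff_polymaps_def inner_add_left coeff_polyfuns.add)

lemma coeff_polymaps_linear:
  assumes "linear h" and f: "f \<in> coeff_polymaps m n"
  shows "(\<lambda>M. h (f M)) \<in> coeff_polymaps m n"
proof -
  interpret linear h by fact
  have eq: "inner (h x) b = (\<Sum>b'\<in>Basis. inner x b' * inner (h b') b)" for x b
    by (subst euclidean_representation[of x, symmetric])
      (simp add: sum scale inner_sum_left del: euclidean_representation)
  have "(\<lambda>M. inner (h (f M)) b) \<in> coeff_polyfuns m n" if "b \<in> Basis" for b
  proof -
    have "(\<lambda>M. inner (h (f M)) b) = (\<lambda>M. \<Sum>b'\<in>Basis. inner (f M) b' * inner (h b') b)"
      by (rule ext) (rule eq)
    also have "\<dots> \<in> coeff_polyfuns m n"
      using f by (auto simp: coeff_polymaps_def intro!: coeff_polyfuns_sum coeff_polyfuns.mult coeff_polyfuns.const)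
    finally show ?thesis .
  qed
  then show ?thesis by (simp add: coeff_polymaps_def)
qed

text \<open>Multiplication is real bilinear; the numbers \<open>inner (b1 * b2) b\<close> are its
  structure constants.\<close>

lemma coeff_polymaps_mult:
  fixes f g :: "'a::{real_normed_field,euclidean_space} poly mat \<Rightarrow> 'a"
  assumes f: "f \<in> coeff_polymaps m n" and g: "g \<in> coeff_polymaps m n"
  shows "(\<lambda>M. f M * g M) \<in> coeff_polymaps m n"
proof -
  have eq: "inner (x * y) b = (\<Sum>b1\<in>Basis. \<Sum>b2\<in>Basis. inner x b1 * inner y b2 * inner (b1 * b2) b)" for x y b :: 'a
  proof -
    have "x * y = (\<Sum>b1\<in>Basis. inner x b1 *\<^sub>R b1) * (\<Sum>b2\<in>Basis. inner y b2 *\<^sub>R b2)"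
      by (simp add: euclidean_representation)
    also have "\<dots> = (\<Sum>b1\<in>Basis. \<Sum>b2\<in>Basis. (inner x b1 * inner y b2) *\<^sub>R (b1 * b2))"
      by (simp add: sum_product mult.commute)
    finally show ?thesis by (simp add: inner_sum_left)
  qed
  have "(\<lambda>M. inner (f M * g M) b) \<in> coeff_polyfuns m n" for b
  proof -
    have "(\<lambda>M. inner (f M * g M) b) =
        (\<lambda>M. \<Sum>b1\<in>Basis. \<Sum>b2\<in>Basis. inner (f M) b1 * inner (g M) b2 * inner (b1 * b2) b)"
      by (rule ext) (rule eq)
    also have "\<dots> \<in> coeff_polyfuns m n"
      using f g by (auto simp: coeff_polymaps_def intro!: coeff_polyfuns_sum coeff_polyfuns.mult coeff_polyfuns.const)
    finally show ?thesis .
  qed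
  then show ?thesis by (simp add: coeff_polymaps_def)
qed

lemma coeff_polymaps_sum:
  "(\<And>x. x \<in> S \<Longrightarrow> f x \<in> coeff_polymaps m n) \<Longrightarrow> (\<lambda>M. \<Sum>x\<in>S. f x M) \<in> coeff_polymaps m n"
  by (induction S rule: infinite_finite_induct) (auto intro: coeff_polymaps_const coeff_polymaps_add)

lemma coeff_polymaps_prod:
  fixes f :: "'b \<Rightarrow> 'a::{real_normed_field,euclidean_space} poly mat \<Rightarrow> 'a"
  shows "(\<And>x. x \<in> S \<Longrightarrow> f x \<in> coeff_polymaps m n) \<Longrightarrow> (\<lambda>M. \<Prod>x\<in>S. f x M) \<in> coeff_polymaps m n"
  by (induction S rule: infinite_finite_induct) (auto intro: coeff_polymaps_const coeff_polymaps_mult)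

lemma coeff_polymaps_det:
  fixes A :: "'a::{real_normed_field,euclidean_space} poly mat \<Rightarrow> 'a mat"
  assumes "\<And>M. A M \<in> carrier_mat N N"
    and "\<And>r s. r < N \<Longrightarrow> s < N \<Longrightarrow> (\<lambda>M. A M $$ (r, s)) \<in> coeff_polymaps m n"
  shows "(\<lambda>M. det (A M)) \<in> coeff_polymaps m n"
proof -
  have "(\<lambda>M. det (A M)) = (\<lambda>M. \<Sum>p\<in>{p. p permutes {0..<N}}. signof p * (\<Prod>i = 0..<N. A M $$ (i, p i)))"
    by (rule ext) (simp add: det_def'[OF assms(1)])
  also have "\<dots> \<in> coeff_polymaps m n"
    by (intro coeff_polymaps_sum coeff_polymaps_mult coeff_polymaps_const coeff_polymaps_prod assms(2))
      (auto dest: permutes_in_image)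
  finally show ?thesis .
qed

text \<open>A sum of squares of real coordinates vanishes only if all of them do, so one real
  equation replaces a field-valued one.\<close>

lemma coeff_polymaps_zero_set:
  assumes "f \<in> coeff_polymaps m n"
  obtains g where "g \<in> coeff_polyfuns m n" "\<And>M. g M = 0 \<longleftrightarrow> f M = 0"
proof
  show "(\<lambda>M. \<Sum>b\<in>Basis. inner (f M) b * inner (f M) b) \<in> coeff_polyfuns m n"
    using assms by (auto simp: coeff_polymaps_def intro!: coeff_polyfuns_sum coeff_polyfuns.mult)
  show "(\<Sum>b\<in>Basis. inner (f M) b * inner (f M) b) = 0 \<longleftrightarrow> f M = 0" for M
    by (simp add: sum_nonneg_eq_0_iff euclidean_all_zero_iff)
qed

lemma coeff_polyfuns_mpoly:
  fixes f :: "'a::{field,euclidean_space} poly mat \<Rightarrow> real"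
  assumes f: "f \<in> coeff_polyfuns m n"
    and W: "\<And>i c j b. i < m \<Longrightarrow> c < m + n \<Longrightarrow> j \<le> d ! i \<Longrightarrow> b \<in> Basis \<Longrightarrow>
      \<exists>s<N. \<forall>M\<in>polmat_space m n d. inner (poly.coeff (M $$ (i, c)) j) b = W M $ s"
  shows "\<exists>p\<in>mpolys_in N. \<forall>M\<in>polmat_space m n d. f M = mpoly_eval p (W M)"
  using f
proof induction
  case (const a)
  show ?case by (rule bexI[OF _ mpoly_const(1)[of a]]) (simp add: mpoly_const)
next
  case (coeff i c b j)
  show ?case
  proof (cases "j \<le> d ! i")
    case True
    then obtain s where "s < N" "\<forall>M\<in>polmat_space m n d. inner (poly.coeff (M $$ (i, c)) j) b = W M $ s"
      using W coeff by blast
    then show ?thesis using mpoly_var[of s N] by metis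
  next
    case False
    \<comment> \<open>The rule \<open>coeff\<close> admits every \<open>j\<close>; above
      \<open>d ! i\<close> the zero polynomial represents the coefficient on the space.\<close>
    then have "poly.coeff (M $$ (i, c)) j = 0" if "M \<in> polmat_space m n d" for M :: "'a poly mat"
      using that coeff by (intro polmat_coeff_eq_0) auto
    then show ?thesis by (intro bexI[OF _ mpoly_const(1)[of 0]]) (simp add: mpoly_eval_def)
  qed
next
  case (add f g)
  then obtain p q where "p \<in> mpolys_in N" "q \<in> mpolys_in N"
    and "\<And>M. M \<in> polmat_space m n d \<Longrightarrow> f M = mpoly_eval p (W M)"
    and "\<And>M. M \<in> polmat_space m n d \<Longrightarrow> g M = mpoly_eval q (W M)"
    by blast
  then show ?case by (intro bexI[of _ "p + q"] ballI mpolys_in_add) (simp_all add: mpoly_eval_add)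
next
  case (mult f g)
  then obtain p q where "p \<in> mpolys_in N" "q \<in> mpolys_in N"
    and "\<And>M. M \<in> polmat_space m n d \<Longrightarrow> f M = mpoly_eval p (W M)"
    and "\<And>M. M \<in> polmat_space m n d \<Longrightarrow> g M = mpoly_eval q (W M)"
    by blast
  then show ?case by (intro bexI[of _ "p * q"] ballI mpolys_in_mult) (simp_all add: mpoly_eval_mult)
qed

section \<open>Real lines between matrices, and continuity\<close>

definition polmat_line :: "nat \<Rightarrow> nat \<Rightarrow> 'a::real_normed_field poly mat \<Rightarrow> 'a poly mat \<Rightarrow> real \<Rightarrow> 'a poly mat" where
  "polmat_line m n M M' t =
     mat m (m + n) (\<lambda>x. M $$ x + Polynomial.smult (of_real t) (M' $$ x - M $$ x))"

lemma polmat_line_in_space: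
  assumes "M \<in> polmat_space m n d" "M' \<in> polmat_space m n d"
  shows "polmat_line m n M M' t \<in> polmat_space m n d"
  using assms unfolding polmat_space_def polmat_line_def
  by (auto intro!: degree_add_le degree_diff_le order.trans[OF degree_smult_le])

lemma polmat_line_1:
  assumes "M \<in> polmat_space m n d" "M' \<in> polmat_space m n d"
  shows "polmat_line m n M M' 1 = M'"
  using assms by (intro eq_matI) (auto simp: polmat_space_def polmat_line_def)

lemma coeff_polyfuns_line:
  fixes f :: "'a::{real_normed_field,euclidean_space} poly mat \<Rightarrow> real"
  assumes "f \<in> coeff_polyfuns m n"
  shows "\<exists>q. \<forall>t. f (polmat_line m n M M' t) = poly q t"
  using assms
proof induction
  case (const a)
  show ?case by (rule exI[of _ "[:a:]"]) simp
next
  case (coeff i c b j)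
  have "of_real t * x = t *\<^sub>R x" for t and x :: 'a by (simp add: scaleR_conv_of_real)
  then show ?case using coeff
    by (intro exI[of _ "[:inner (poly.coeff (M $$ (i, c)) j) b,
        inner (poly.coeff (M' $$ (i, c)) j - poly.coeff (M $$ (i, c)) j) b:]"])
      (simp add: polmat_line_def inner_add_left)
next
  case (add f g)
  then show ?case by (metis poly_add)
next
  case (mult f g)
  then show ?case by (metis poly_mult)
qed

lemma polmat_dist_line:
  "polmat_dist m n d M (polmat_line m n M M' t) = \<bar>t\<bar> * polmat_dist m n d M M'"
proof -
  have "polmat_dist m n d M (polmat_line m n M M' t) =
      sqrt (\<Sum>i<m. \<Sum>j\<le>d ! i. \<Sum>c<m + n. t\<^sup>2 * (norm ((row_coeff m n M i j - row_coeff m n M' i j) $ c))\<^sup>2)"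
    unfolding polmat_dist_def
    by (intro arg_cong[where f = sqrt] sum.cong refl)
      (simp add: row_coeff_def polmat_line_def norm_mult power_mult_distrib norm_minus_commute)
  also have "\<dots> = sqrt (t\<^sup>2 * (\<Sum>i<m. \<Sum>j\<le>d ! i. \<Sum>c<m + n. (norm ((row_coeff m n M i j - row_coeff m n M' i j) $ c))\<^sup>2))"
    by (simp add: sum_distrib_left)
  finally show ?thesis by (simp add: polmat_dist_def real_sqrt_mult)
qed

lemma coeff_dist_le:
  assumes "i < m" "c < m + n" "j \<le> d ! i"
  shows "norm (poly.coeff (M $$ (i, c)) j - poly.coeff (M' $$ (i, c)) j) \<le> polmat_dist m n d M M'"
proof -
  let ?t = "\<lambda>i j c. (norm ((row_coeff m n M i j - row_coeff m n M' i j) $ c))\<^sup>2"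
  have "?t i j c \<le> (\<Sum>c<m + n. ?t i j c)"
    using assms by (intro member_le_sum) auto
  also have "\<dots> \<le> (\<Sum>j\<le>d ! i. \<Sum>c<m + n. ?t i j c)"
    using assms by (intro member_le_sum) (auto intro: sum_nonneg)
  also have "\<dots> \<le> (\<Sum>i<m. \<Sum>j\<le>d ! i. \<Sum>c<m + n. ?t i j c)"
    using assms by (intro member_le_sum[of i _ "\<lambda>i. \<Sum>j\<le>d ! i. \<Sum>c<m + n. ?t i j c"]) (auto intro!: sum_nonneg)
  finally have "sqrt (?t i j c) \<le> polmat_dist m n d M M'"
    unfolding polmat_dist_def by (rule real_sqrt_le_mono)
  then show ?thesis using assms by (simp add: row_coeff_def)
qed

text \<open>Each real coordinate is 1-Lipschitz for the metric; sums and products preserve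
  continuity.\<close>

lemma coeff_polyfuns_continuous:
  fixes f :: "'a::{real_normed_field,euclidean_space} poly mat \<Rightarrow> real"
  assumes "f \<in> coeff_polyfuns m n"
  shows "continuous_map (polmat_topology m n d) euclideanreal f"
  using assms
proof induction
  case (coeff i c b j)
  interpret X: Metric_space "polmat_space m n d :: 'a poly mat set" "polmat_dist m n d"
    by (rule Metric_space_polmat)
  have lip: "\<bar>inner (poly.coeff (M $$ (i, c)) j) b - inner (poly.coeff (M' $$ (i, c)) j) b\<bar> \<le> polmat_dist m n d M M'"
    if MM: "M \<in> polmat_space m n d" "M' \<in> polmat_space m n d" for M M' :: "'a poly mat"
  proof (cases "j \<le> d ! i")
    case True
    have "\<bar>inner (poly.coeff (M $$ (i, c)) j - poly.coeff (M' $$ (i, c)) j) b\<bar>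
        \<le> norm (poly.coeff (M $$ (i, c)) j - poly.coeff (M' $$ (i, c)) j)"
      using coeff by (intro Basis_le_norm)
    then show ?thesis using coeff_dist_le[of i m c n j d M M'] True coeff by (simp add: inner_diff_left)
  next
    case False
    then have "poly.coeff (M $$ (i, c)) j = 0" "poly.coeff (M' $$ (i, c)) j = 0"
      using MM coeff by (auto intro: polmat_coeff_eq_0)
    then show ?thesis by simp
  qed
  have "continuous_map X.mtopology Met_TC.mtopology (\<lambda>M. inner (poly.coeff (M $$ (i, c)) j) b)"
    unfolding Metric_space.continuous_map_to_metric[OF Met_TC.Metric_space_axioms]
  proof (intro ballI allI impI)
    fix M :: "'a poly mat" and e :: real
    assume "M \<in> topspace X.mtopology" and e: "0 < e"
    then have M: "M \<in> polmat_space m n d" by simp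
    show "\<exists>U. openin X.mtopology U \<and> M \<in> U \<and>
      (\<forall>M'\<in>U. inner (poly.coeff (M' $$ (i, c)) j) b \<in> Met_TC.mball (inner (poly.coeff (M $$ (i, c)) j) b) e)"
    proof (intro exI conjI ballI)
      show "openin X.mtopology (X.mball M e)" by simp
      show "M \<in> X.mball M e" using M e by simp
      fix M' assume "M' \<in> X.mball M e"
      then show "inner (poly.coeff (M' $$ (i, c)) j) b \<in> Met_TC.mball (inner (poly.coeff (M $$ (i, c)) j) b) e"
        using lip[of M M'] by (simp add: dist_real_def)
    qed
  qed
  then show ?case by simp
next
  case (add f g)
  then show ?case by (intro continuous_map_add) auto
next
  case (mult f g)
  then show ?case by (intro continuous_map_real_mult) auto
qed simp

section \<open>Full trimmed Sylvester rank is generic\<close>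

text \<open>Covers \<open>real\<close> and \<open>complex\<close> at once; real coordinates are taken with respect to \<open>Basis\<close>.\<close>

class conj_euclidean = real_normed_field + euclidean_space + conjugatable_ordered_field +
  assumes conjugate_scaleR: "conjugate (r *\<^sub>R x) = r *\<^sub>R conjugate x"

instance real :: conj_euclidean
  by standard simp

instance complex :: conj_euclidean
  by standard simp

lemma linear_conjugate: "linear (conjugate :: 'a \<Rightarrow> 'a::conj_euclidean)"
  by (simp add: linear_iff conjugate_dist_add conjugate_scaleR)

lemma trivial_kernel_polyfun:
  fixes B :: "'a::conj_euclidean poly mat \<Rightarrow> 'x \<Rightarrow> 'y \<Rightarrow> 'a"
  assumes I: "finite I" and J: "finite J"
    and B: "\<And>x y. x \<in> I \<Longrightarrow> y \<in> J \<Longrightarrow> (\<lambda>M. B M x y) \<in> coeff_polymaps m n"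
  obtains h where "h \<in> coeff_polyfuns m n" "\<And>M. h M \<noteq> 0 \<longleftrightarrow> trivial_kernel I J (B M)"
proof -
  obtain g where g: "bij_betw g {..<card J} J"
    using ex_bij_betw_nat_finite[OF J] by (auto simp: atLeast0LessThan)
  have gJ: "g r \<in> J" if "r < card J" for r using g that by (auto dest: bij_betwE)
  have "(\<lambda>M. det (gram_mat I g (card J) (B M))) \<in> coeff_polymaps m n"
  proof (rule coeff_polymaps_det)
    fix r s assume rs: "r < card J" "s < card J"
    have "(\<lambda>M. gram_mat I g (card J) (B M) $$ (r, s)) = (\<lambda>M. \<Sum>x\<in>I. conjugate (B M x (g r)) * B M x (g s))"
      using rs by (simp add: gram_mat_def)
    also have "\<dots> \<in> coeff_polymaps m n"
      using rs by (intro coeff_polymaps_sum coeff_polymaps_mult coeff_polymaps_linear[OF linear_conjugate] B gJ)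
    finally show "(\<lambda>M. gram_mat I g (card J) (B M) $$ (r, s)) \<in> coeff_polymaps m n" .
  qed (simp add: gram_mat_def)
  then obtain h where h: "h \<in> coeff_polyfuns m n" "\<And>M. h M = 0 \<longleftrightarrow> det (gram_mat I g (card J) (B M)) = 0"
    by (elim coeff_polymaps_zero_set) blast
  show ?thesis using that[OF h(1)] h(2) det_gram_mat_iff[OF I g] by blast
qed

lemma TSyl_polyfun:
  fixes m n :: nat and d :: "nat list"
  assumes mnd: "m > 0" "n > 0" "length d = m"
  obtains f :: "'a::conj_euclidean poly mat \<Rightarrow> real" where "f \<in> coeff_polyfuns m n"
    "\<And>M. M \<in> polmat_space m n d \<Longrightarrow> M \<in> TSyl m n d \<longleftrightarrow> f M \<noteq> 0"
proof -
  let ?k = "sum_list d div n"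
  have entry: "(\<lambda>M :: 'a poly mat. syl_entry M x y) \<in> coeff_polymaps m n"
    if xy: "x \<in> syl_rows m d k" "y \<in> syl_cols m n k" for x y k
  proof -
    obtain i p c q where "x = (i, p)" "y = (c, q)" "i < m" "c < m + n"
      using xy by (auto simp: syl_rows_def syl_cols_def)
    then show ?thesis
      by (cases "q \<le> p") (simp_all add: syl_entry_def coeff_polymaps_const coeff_polymaps_coeff)
  qed
  have fin: "finite (syl_rows m d k)" "finite (syl_cols m n k)" for k
    by (simp_all add: syl_rows_def syl_cols_def)
  obtain f :: "'a poly mat \<Rightarrow> real" where f: "f \<in> coeff_polyfuns m n" "\<And>M. f M \<noteq> 0 \<longleftrightarrow> right_inj m n d ?k M"
    using trivial_kernel_polyfun[OF fin(1)[of ?k] fin(2)[of ?k], of syl_entry m n] entry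
    unfolding right_inj_def by metis
  obtain g :: "'a poly mat \<Rightarrow> real" where g: "g \<in> coeff_polyfuns m n" "\<And>M. g M \<noteq> 0 \<longleftrightarrow> left_inj m n d (Suc ?k) M"
    using trivial_kernel_polyfun[OF fin(2)[of "Suc ?k"] fin(1)[of "Suc ?k"], of "\<lambda>M y x. syl_entry M x y" m n] entry
    unfolding left_inj_def by metis
  show ?thesis
  proof
    show "(\<lambda>M. f M * g M) \<in> coeff_polyfuns m n" using f g by (intro coeff_polyfuns.mult)
  qed (simp add: TSyl_iff[OF mnd] f g)
qed

lemma TSyl_nonempty:
  assumes mnd: "m > 0" "n > 0" "length d = m"
  shows "(TSyl m n d :: 'a::field poly mat set) \<noteq> {}"
proof -
  obtain M :: "'a poly mat" where M: "M \<in> polmat_space m n d"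
    and "\<And>k. k * n \<le> sum_list d \<Longrightarrow> right_inj m n d k M"
    and "\<And>k. sum_list d \<le> k * n \<Longrightarrow> left_inj m n d k M"
    using exists_right_left_inj[OF mnd] by metis
  moreover have "sum_list d \<le> Suc (sum_list d div n) * n"
    using mnd(2) dividend_less_div_times[of n "sum_list d"] by simp
  ultimately have "M \<in> TSyl m n d" by (simp add: TSyl_iff[OF mnd])
  then show ?thesis by blast
qed

lemma TSyl_open_dense:
  fixes m n :: nat and d :: "nat list"
  assumes mnd: "m > 0" "n > 0" "length d = m"
  shows "openin (polmat_topology m n d) (TSyl m n d :: 'a::conj_euclidean poly mat set)"
    and "polmat_topology m n d closure_of (TSyl m n d :: 'a::conj_euclidean poly mat set) = polmat_space m n d"
proof -
  interpret X: Metric_space "polmat_space m n d :: 'a poly mat set" "polmat_dist m n d"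
    by (rule Metric_space_polmat)
  obtain f :: "'a poly mat \<Rightarrow> real" where f: "f \<in> coeff_polyfuns m n"
    and T: "\<And>M. M \<in> polmat_space m n d \<Longrightarrow> M \<in> TSyl m n d \<longleftrightarrow> f M \<noteq> 0"
    using TSyl_polyfun[OF mnd] by metis
  have "openin X.mtopology {M \<in> topspace X.mtopology. f M \<in> - {0}}"
    by (rule openin_continuous_map_preimage[OF coeff_polyfuns_continuous[OF f]]) auto
  moreover have "{M \<in> topspace X.mtopology. f M \<in> - {0}} = TSyl m n d"
    using T by (auto simp: TSyl_def)
  ultimately show "openin X.mtopology (TSyl m n d)" by simp
  obtain M1 :: "'a poly mat" where M1: "M1 \<in> TSyl m n d" using TSyl_nonempty[OF mnd] by blast
  then have M1X: "M1 \<in> polmat_space m n d" by (simp add: TSyl_def)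
  have "\<exists>M'\<in>TSyl m n d. M' \<in> X.mball M r" if M: "M \<in> polmat_space m n d" and r: "r > 0" for M r
  proof -
    obtain q where q: "\<And>t. f (polmat_line m n M M1 t) = poly q t"
      using coeff_polyfuns_line[OF f] by metis
    have "poly q 1 \<noteq> 0" using q[of 1] T[OF M1X] M1 by (simp add: polmat_line_1[OF M M1X])
    then have "finite {t. poly q t = 0}" by (intro poly_roots_finite) auto
    \<comment> \<open>The summand 1 keeps the denominator positive even if \<open>M = M1\<close>;
      \<open>t < e\<close> keeps the point inside the ball.\<close>
    moreover define e where "e = r / (polmat_dist m n d M M1 + 1)"
    have D: "polmat_dist m n d M M1 \<ge> 0" by simp
    have "e > 0" using r D by (simp add: e_def add_nonneg_pos)
    then have "infinite {0<..<e}" by simp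
    ultimately obtain t where t: "0 < t" "t < e" "poly q t \<noteq> 0"
      by (metis (mono_tags, lifting) finite_subset greaterThanLessThan_iff mem_Collect_eq subsetI)
    let ?M = "polmat_line m n M M1 t"
    have MX: "?M \<in> polmat_space m n d" by (rule polmat_line_in_space[OF M M1X])
    have "t * polmat_dist m n d M M1 \<le> t * (polmat_dist m n d M M1 + 1)" using t by simp
    also have "\<dots> < r" using t D by (simp add: e_def pos_less_divide_eq)
    finally have "?M \<in> X.mball M r" using t M MX by (simp add: polmat_dist_line)
    moreover have "?M \<in> TSyl m n d" using T[OF MX] q t by simp
    ultimately show ?thesis by blast
  qed
  then show "X.mtopology closure_of (TSyl m n d) = polmat_space m n d"
    unfolding X.metric_closure_of by blast
qed

text \<open>Since \<open>f M\<close> is a polynomial in \<open>W M\<close> and \<open>W\<close>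
  reaches every vector, the image of the complement is exactly its zero set. Abstracting
  \<open>W\<close> treats \<open>coord_vec\<close> and \<open>coord_vec_reim\<close>
  together.\<close>

lemma TSyl_algebraic:
  fixes W :: "'a::conj_euclidean poly mat \<Rightarrow> real vec"
  assumes mnd: "m > 0" "n > 0" "length d = m"
    and surj: "W ` polmat_space m n d = carrier_vec N"
    and coord: "\<And>i c j b. i < m \<Longrightarrow> c < m + n \<Longrightarrow> j \<le> d ! i \<Longrightarrow> b \<in> Basis \<Longrightarrow>
      \<exists>s<N. \<forall>M\<in>polmat_space m n d. inner (poly.coeff (M $$ (i, c)) j) b = W M $ s"
  shows "proper_algebraic_set N (W ` (polmat_space m n d - TSyl m n d))"
    and "generic_set N (W ` TSyl m n d)"
proof -
  let ?X = "polmat_space m n d :: 'a poly mat set"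
  obtain f :: "'a poly mat \<Rightarrow> real" where f: "f \<in> coeff_polyfuns m n"
    and T: "\<And>M. M \<in> ?X \<Longrightarrow> M \<in> TSyl m n d \<longleftrightarrow> f M \<noteq> 0"
    using TSyl_polyfun[OF mnd] by metis
  obtain p where p: "p \<in> mpolys_in N" and fp: "\<And>M. M \<in> ?X \<Longrightarrow> f M = mpoly_eval p (W M)"
    using coeff_polyfuns_mpoly[OF f coord] by blast
  have eq: "W ` (?X - TSyl m n d) = {x \<in> carrier_vec N. \<forall>q\<in>{p}. mpoly_eval q x = 0}"
    using T fp by (auto simp flip: surj)
  then have "algebraic_set N (W ` (?X - TSyl m n d))"
    unfolding algebraic_set_def using p by (intro exI[of _ "{p}"]) simp
  moreover obtain M1 where M1: "M1 \<in> (TSyl m n d :: 'a poly mat set)" using TSyl_nonempty[OF mnd] by blast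
  then have "M1 \<in> ?X" by (simp add: TSyl_def)
  then have "W M1 \<in> carrier_vec N" "W M1 \<notin> W ` (?X - TSyl m n d)"
    using M1 T fp surj by (auto simp: eq)
  ultimately show A: "proper_algebraic_set N (W ` (?X - TSyl m n d))"
    unfolding proper_algebraic_set_def by blast
  have "TSyl m n d \<subseteq> ?X" by (auto simp: TSyl_def)
  then have "W ` TSyl m n d \<subseteq> carrier_vec N"
    "carrier_vec N - W ` TSyl m n d \<subseteq> W ` (?X - TSyl m n d)"
    unfolding surj[symmetric] by blast+
  with A show "generic_set N (W ` TSyl m n d)" unfolding generic_set_def by blast
qed

section \<open>Coordinate vectors\<close>

text \<open>The triples follow the order of \<open>coord_vec\<close>, so a vector index can be
  looked up as a list position.\<close>

definition coord_list :: "nat \<Rightarrow> nat \<Rightarrow> nat list \<Rightarrow> (nat \<times> nat \<times> nat) list" where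
  "coord_list m n d = concat (map (\<lambda>i.
     concat (map (\<lambda>j. map (\<lambda>c. (i, j, c)) [0..<m + n]) [0..<d ! i + 1])) [0..<m])"

lemma coord_vec_coord_list:
  "coord_vec m n d M = vec_of_list (map (\<lambda>(i, j, c). poly.coeff (M $$ (i, c)) j) (coord_list m n d))"
  by (simp add: coord_vec_def coord_list_def row_coeff_def list_of_vec_vec map_concat comp_def)

lemma set_coord_list: "set (coord_list m n d) = (SIGMA i:{..<m}. {..d ! i} \<times> {..<m + n})"
  by (auto simp: coord_list_def image_iff less_Suc_eq_le simp del: upt_Suc)

lemma length_coord_list: "length (coord_list m n d) = coord_dim m n d"
  by (simp add: coord_list_def coord_dim_def length_concat comp_def sum_list_distinct_conv_sum_set
      sum_distrib_left atLeast0LessThan algebra_simps sum_list_triv)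

lemma bij_betw_coord_list:
  "bij_betw ((!) (coord_list m n d)) {..<coord_dim m n d} (SIGMA i:{..<m}. {..d ! i} \<times> {..<m + n})"
proof -
  have "card (set (coord_list m n d)) = length (coord_list m n d)"
    by (simp add: set_coord_list length_coord_list coord_dim_def sum_distrib_left algebra_simps)
  then have "distinct (coord_list m n d)" by (rule card_distinct)
  then show ?thesis by (intro bij_betw_nth) (simp_all add: length_coord_list set_coord_list)
qed

lemma coord_vec_index:
  assumes "i < m" "c < m + n" "j \<le> d ! i"
  obtains s where "s < coord_dim m n d" "\<And>M. coord_vec m n d M $ s = poly.coeff (M $$ (i, c)) j"
proof -
  have "(i, j, c) \<in> (!) (coord_list m n d) ` {..<coord_dim m n d}"
    using assms bij_betw_imp_surj_on[OF bij_betw_coord_list[of m n d]] by auto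
  then obtain s where s: "s < coord_dim m n d" "coord_list m n d ! s = (i, j, c)" by auto
  show ?thesis
    by (rule that[OF s(1)]) (use s in \<open>simp add: coord_vec_coord_list length_coord_list vec_of_list_index\<close>)
qed

lemma coord_vec_carrier: "coord_vec m n d M \<in> carrier_vec (coord_dim m n d)"
  by (rule carrier_vecI) (simp add: coord_vec_coord_list length_coord_list)

lemma coord_vec_surj:
  "coord_vec m n d ` polmat_space m n d = (carrier_vec (coord_dim m n d) :: 'a::field vec set)"
proof
  show "carrier_vec (coord_dim m n d) \<subseteq> coord_vec m n d ` (polmat_space m n d :: 'a poly mat set)"
  proof
    fix x :: "'a vec" assume x: "x \<in> carrier_vec (coord_dim m n d)"
    let ?L = "coord_list m n d"
    define val where "val = (\<lambda>t. x $ (the_inv_into {..<coord_dim m n d} ((!) ?L) t))"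
    have val: "val (?L ! s) = x $ s" if "s < coord_dim m n d" for s
      using that bij_betw_coord_list[of m n d] by (simp add: val_def the_inv_into_f_f bij_betw_def)
    define M where "M = mat m (m + n) (\<lambda>(i, c). \<Sum>j\<le>d ! i. Polynomial.monom (val (i, j, c)) j)"
    have M: "M \<in> polmat_space m n d"
      by (auto simp: M_def polmat_space_def intro!: degree_sum_le order.trans[OF degree_monom_le])
    have "poly.coeff (M $$ (i, c)) j = val (i, j, c)" if "(i, j, c) \<in> set ?L" for i j c
      using that by (auto simp: M_def set_coord_list coeff_sum)
    then have "coord_vec m n d M $ s = val (?L ! s)" if "s < coord_dim m n d" for s
      using that nth_mem[of s ?L]
      by (cases "?L ! s") (simp add: coord_vec_coord_list length_coord_list vec_of_list_index)
    then have "coord_vec m n d M = x"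
      using x val coord_vec_carrier[of m n d M] by (intro eq_vecI) auto
    then show "x \<in> coord_vec m n d ` polmat_space m n d" using M by blast
  qed
qed (use coord_vec_carrier in blast)

lemma coord_vec_reim_surj:
  "coord_vec_reim m n d ` polmat_space m n d = carrier_vec (2 * coord_dim m n d)"
proof
  show "coord_vec_reim m n d ` polmat_space m n d \<subseteq> carrier_vec (2 * coord_dim m n d)"
    using coord_vec_carrier by (auto simp: coord_vec_reim_def mult_2 intro!: append_carrier_vec)
  show "carrier_vec (2 * coord_dim m n d) \<subseteq> coord_vec_reim m n d ` polmat_space m n d"
  proof
    fix x :: "real vec" assume x: "x \<in> carrier_vec (2 * coord_dim m n d)"
    let ?N = "coord_dim m n d"
    \<comment> \<open>The two halves of \<open>x\<close> become real and imaginary parts, reducing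
      the claim to \<open>coord_vec_surj\<close>.\<close>
    let ?z = "vec ?N (\<lambda>s. Complex (x $ s) (x $ (?N + s)))"
    have "?z \<in> coord_vec m n d ` polmat_space m n d" by (simp add: coord_vec_surj)
    then obtain M where M: "M \<in> polmat_space m n d" "coord_vec m n d M = ?z" by auto
    have "coord_vec_reim m n d M = x"
      using x by (intro eq_vecI) (auto simp: coord_vec_reim_def M(2))
    then show "x \<in> coord_vec_reim m n d ` polmat_space m n d" using M by blast
  qed
qed

lemma TSyl_algebraic_real:
  assumes mnd: "m > 0" "n > 0" "length d = m"
  shows "proper_algebraic_real m n d (polmat_space m n d - TSyl m n d)"
    and "generic_real m n d (TSyl m n d)"
proof -
  have coord: "\<exists>s<coord_dim m n d. \<forall>M\<in>polmat_space m n d.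
      inner (poly.coeff (M $$ (i, c)) j) b = coord_vec m n d M $ s"
    if ij: "i < m" "c < m + n" "j \<le> d ! i" and b: "b \<in> Basis" for i c j and b :: real
  proof -
    obtain s where "s < coord_dim m n d"
      and "\<And>M :: real poly mat. coord_vec m n d M $ s = poly.coeff (M $$ (i, c)) j"
      using coord_vec_index[OF ij, where 'a = real] by metis
    then show ?thesis using b by auto
  qed
  note * = TSyl_algebraic[OF mnd coord_vec_surj coord]
  show "proper_algebraic_real m n d (polmat_space m n d - TSyl m n d)"
    using *(1) by (auto simp: proper_algebraic_real_def)
  show "generic_real m n d (TSyl m n d)"
    using *(2) by (auto simp: generic_real_def TSyl_def)
qed

lemma TSyl_algebraic_complex:
  assumes mnd: "m > 0" "n > 0" "length d = m"
  shows "proper_algebraic_complex m n d (polmat_space m n d - TSyl m n d)"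
    and "generic_complex m n d (TSyl m n d)"
proof -
  have coord: "\<exists>s<2 * coord_dim m n d. \<forall>M\<in>polmat_space m n d.
      inner (poly.coeff (M $$ (i, c)) j) b = coord_vec_reim m n d M $ s"
    if ij: "i < m" "c < m + n" "j \<le> d ! i" and b: "b \<in> Basis" for i c j and b :: complex
  proof -
    obtain s where s: "s < coord_dim m n d" and V: "\<And>M :: complex poly mat. coord_vec m n d M $ s = poly.coeff (M $$ (i, c)) j"
      using coord_vec_index[OF ij, where 'a = complex] by metis
    have dim: "dim_vec (coord_vec m n d M) = coord_dim m n d" for M :: "complex poly mat"
      using coord_vec_carrier[of m n d M] by simp
    have "b = 1 \<or> b = \<i>" using b by (auto simp: Basis_complex_def)
    then show ?thesis
    proof
      assume "b = 1"
      then show ?thesis using s V dim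
        by (intro exI[of _ s]) (simp add: coord_vec_reim_def inner_complex_def)
    next
      assume "b = \<i>"
      then show ?thesis using s V dim
        by (intro exI[of _ "coord_dim m n d + s"]) (simp add: coord_vec_reim_def inner_complex_def)
    qed
  qed
  note * = TSyl_algebraic[OF mnd coord_vec_reim_surj coord]
  show "proper_algebraic_complex m n d (polmat_space m n d - TSyl m n d)"
    using *(1) by (auto simp: proper_algebraic_complex_def)
  show "generic_complex m n d (TSyl m n d)"
    using *(2) by (auto simp: generic_complex_def TSyl_def)
qed

theorem theorem6p2:
  fixes m n :: nat and d :: "nat list"
  assumes "m > 0" and "n > 0" and "length d = m" and "Max (set d) > 0"
  shows
    "(proper_algebraic_real m n d (polmat_space m n d - TSyl m n d)
      \<and> generic_real m n d (TSyl m n d)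
      \<and> openin (polmat_topology m n d) (TSyl m n d :: real poly mat set)
      \<and> polmat_topology m n d closure_of (TSyl m n d :: real poly mat set) = polmat_space m n d)
     \<and>
     (proper_algebraic_complex m n d (polmat_space m n d - TSyl m n d)
      \<and> generic_complex m n d (TSyl m n d)
      \<and> openin (polmat_topology m n d) (TSyl m n d :: complex poly mat set)
      \<and> polmat_topology m n d closure_of (TSyl m n d :: complex poly mat set) = polmat_space m n d)"
  by (intro conjI TSyl_algebraic_real TSyl_algebraic_complex TSyl_open_dense assms(1-3))

end
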